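(* Let $\mathcal U$ be a variety with a difference term in the signature $\tau$, let $A\in\mathcal U$, and let $\pi: A\to Q$ be a central extension realizing central datum $(Q,B^{\tau})$ (identify $A=B^{\tau}\otimes^{T}Q$, $\pi=p_2$, for a $\mathcal U$-compatible 2-cocycle $T$). If $E^{\tau}\in\mathcal U$ is a kernel algebra, then $$0\to \mathrm{Hom}(Q,E^{\tau})\xrightarrow{\check\sigma}\mathrm{Hom}(A,E^{\tau})\xrightarrow{\check r}\mathrm{Hom}(B^{\tau},E^{\tau})\xrightarrow{\delta}H^{2}_{\mathcal U}(Q,E^{\tau})\xrightarrow{\check\sigma}H^{2}_{\mathcal U}(A,E^{\tau})$$ is a finite complex of abelian groups which is exact at the first three groups $\mathrm{Hom}(Q,E^\tau)$, $\mathrm{Hom}(A,E^\tau)$, $\mathrm{Hom}(B^\tau,E^\tau)$. If moreover there is a free presentation $F_{\mathcal U}(X)/\theta\cong Q$ in $\mathcal U$ such that $F_{\mathcal U}(X)/[\theta,1]$ has an idempotent element, then the sequence is exact (that is, also $\operatorname{im}\delta=\ker\check\sigma$ in $H^{2}_{\mathcal U}(Q,E^{\tau})$).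
   Context: Conventions. Algebras are universal algebras in a signature $\tau$; $[\alpha,\beta]$ is the term-condition commutator of congruences; $0_A,1_A$ are the least and greatest congruences of $A$ (written $0,1$). A variety $\mathcal U$ has a difference term if there is a ternary term $m$ with $m(x,x,y)=y$ in $\mathcal U$ and $(x,m(x,y,y))\in[\alpha,\alpha]$ whenever $A\in\mathcal U$ and $(x,y)\in\alpha\in\mathrm{Con}\,A$; it is assumed throughout that $m$ is a fundamental operation symbol of $\tau$. An extension is a surjective homomorphism $\pi:A\to Q$; it is central if $[\ker\pi,1_A]=0_A$. An element $u$ is idempotent if $f(u,\ldots,u)=u$ for all $f\in\tau$. A free presentation of $Q$ in $\mathcal U$ is $F_{\mathcal U}(X)/\theta\cong Q$ with $F_{\mathcal U}(X)$ free in $\mathcal U$ on $X$ and $\theta$ a congruence. Kernel algebras and central datum. A kernel algebra $B^{\tau}$ is a $\tau$-algebra on the universe of a unital module $B$ over a ring $R$ with $1$ in which each $f\in\tau$ is a module term $f^{B}(x_1,\ldots,x_n)=r_1x_1+\cdots+r_nx_n$ $(r_i\in R)$ and $m^{B}(x,y,z)=x-y+z$. Central datum $(Q,B^{\tau})$ in $\mathcal U$ is a kernel algebra $B^{\tau}\in\mathcal U$ and an algebra $Q\in\mathcal U$. Cocycles. A 2-cocycle for $(Q,B^{\tau})$ is a family $T=\{T_f:Q^{\mathrm{ar} f}\to B\}_{f\in\tau}$. The algebra $B^{\tau}\otimes^{T}Q$ has universe $B\times Q$ and operations $F_f((b_1,q_1),\ldots,(b_n,q_n))=(f^{B}(\vec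 b)+T_f(\vec q),f^{Q}(\vec q))$; $p_2$ is its second projection to $Q$. For a term $t$ define $t^{\partial,T}$ by $x^{\partial,T}=0$ for a variable and $f(t_1,\ldots,t_n)^{\partial,T}=f^{B}(t_1^{\partial,T},\ldots,t_n^{\partial,T})+T_f(t_1^{Q},\ldots,t_n^{Q})$. $T$ is $\mathcal U$-compatible if $t^{\partial,T}=g^{\partial,T}$ under all evaluations in $Q$ for every identity $t=g$ of $\mathcal U$. A 2-coboundary is a family $G_f(\vec x)=f^{B}(h(\vec x))-h(f^{Q}(\vec x))$ for some function $h:Q\to B$. Under pointwise addition, $H^{2}_{\mathcal U}(Q,B^{\tau})$ is the group of $\mathcal U$-compatible 2-cocycles modulo 2-coboundaries. A central extension $\pi:A\to Q$, $A\in\mathcal U$, realizes $(Q,B^{\tau})$ and is represented by $[T]$ if there is an isomorphism $\psi:A\to B^{\tau}\otimes^{T}Q$ with $p_2\circ\psi=\pi$, $T$ being $\mathcal U$-compatible. Hom groups and maps. $\mathrm{Hom}(B^{\tau},E^{\tau})$, for kernel algebras, is the abelian group of $\tau$-homomorphisms preserving $0$; $\mathrm{Hom}(Q,E^{\tau})$ and $\mathrm{Hom}(A,E^{\tau})$ are the abelian groups (pointwise addition) of $\tau$-homomorphisms. Inflation: $\check\sigma(\phi)=\phi\circ\pi$ and $\check\sigma([S])=[S\circ\pi]$, $(S\circ\pi)_f(\vec a)=S_f(\pi(a_1),\ldots,\pi(a_n))$. Restriction: $\check r(\phi)(b)=\phi(b,q)-\phi(0,q)$ for any $q\in Q$ (independent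 of $q$). Transgression: $\delta(\phi)=\delta_T(\phi)=[\phi\circ T]$. A complex is exact at a group if the image of the incoming map equals the kernel of the outgoing map. *)

theory Defs
  imports "HOL-Algebra.Coset" "HOL-Algebra.Module"
begin

section \<open>Universal algebra\<close>

text \<open>A signature is a type \<open>'f\<close> of operation symbols with an arity function \<open>ar\<close>. Operations take
  argument lists; only their values on lists of the right length over the carrier matter.\<close>

record ('f, 'a) ualg = "'a partial_object" +
  oper :: "'f \<Rightarrow> 'a list \<Rightarrow> 'a"

datatype ('f, 'v) trm = Var 'v | App 'f "('f, 'v) trm list"

definition tuples :: "nat \<Rightarrow> 'a set \<Rightarrow> 'a list set" where
  "tuples n S = {xs. length xs = n \<and> set xs \<subseteq> S}"

inductive_set terms :: "('f \<Rightarrow> nat) \<Rightarrow> 'v set \<Rightarrow> ('f, 'v) trm set"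
  for ar :: "'f \<Rightarrow> nat" and X :: "'v set"
where
  terms_Var: "x \<in> X \<Longrightarrow> Var x \<in> terms ar X"
| terms_App: "\<lbrakk>length ts = ar f; \<forall>t\<in>set ts. t \<in> terms ar X\<rbrakk> \<Longrightarrow> App f ts \<in> terms ar X"

primrec eval :: "('f, 'a) ualg \<Rightarrow> ('v \<Rightarrow> 'a) \<Rightarrow> ('f, 'v) trm \<Rightarrow> 'a" where
  "eval A \<rho> (Var x) = \<rho> x"
| "eval A \<rho> (App f ts) = oper A f (map (eval A \<rho>) ts)"

text \<open>Algebras are nonempty, as usual.\<close>

definition is_algebra :: "('f \<Rightarrow> nat) \<Rightarrow> ('f, 'a) ualg \<Rightarrow> bool" where
  "is_algebra ar A \<longleftrightarrow> carrier A \<noteq> {} \<and>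
     (\<forall>f. \<forall>xs \<in> tuples (ar f) (carrier A). oper A f xs \<in> carrier A)"

definition alg_hom :: "('f \<Rightarrow> nat) \<Rightarrow> ('f, 'a) ualg \<Rightarrow> ('f, 'b) ualg \<Rightarrow> ('a \<Rightarrow> 'b) set" where
  "alg_hom ar A B = {h. h \<in> carrier A \<rightarrow> carrier B \<and>
     (\<forall>f. \<forall>xs \<in> tuples (ar f) (carrier A). h (oper A f xs) = oper B f (map h xs))}"

definition alg_iso :: "('f \<Rightarrow> nat) \<Rightarrow> ('f, 'a) ualg \<Rightarrow> ('f, 'b) ualg \<Rightarrow> ('a \<Rightarrow> 'b) set" where
  "alg_iso ar A B = {h \<in> alg_hom ar A B. bij_betw h (carrier A) (carrier B)}"

definition is_congruence :: "('f \<Rightarrow> nat) \<Rightarrow> ('f, 'a) ualg \<Rightarrow> ('a \<times> 'a) set \<Rightarrow> bool" where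
  "is_congruence ar A \<theta> \<longleftrightarrow> equiv (carrier A) \<theta> \<and>
     (\<forall>f. \<forall>xs \<in> tuples (ar f) (carrier A). \<forall>ys \<in> tuples (ar f) (carrier A).
        (\<forall>i < ar f. (xs ! i, ys ! i) \<in> \<theta>) \<longrightarrow> (oper A f xs, oper A f ys) \<in> \<theta>)"

definition one_cong :: "('f, 'a) ualg \<Rightarrow> ('a \<times> 'a) set" where
  "one_cong A = carrier A \<times> carrier A"

definition zero_cong :: "('f, 'a) ualg \<Rightarrow> ('a \<times> 'a) set" where
  "zero_cong A = Id_on (carrier A)"

definition ker_cong :: "('f, 'a) ualg \<Rightarrow> ('a \<Rightarrow> 'q) \<Rightarrow> ('a \<times> 'a) set" where
  "ker_cong A \<pi> = {(x, y). x \<in> carrier A \<and> y \<in> carrier A \<and> \<pi> x = \<pi> y}"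

definition quot_alg :: "('f, 'a) ualg \<Rightarrow> ('a \<times> 'a) set \<Rightarrow> ('f, 'a set) ualg" where
  "quot_alg A \<theta> = \<lparr>carrier = carrier A // \<theta>,
     oper = (\<lambda>f Cs. \<theta> `` {oper A f (map (\<lambda>C. SOME x. x \<in> C) Cs)})\<rparr>"

definition is_idempotent :: "('f \<Rightarrow> nat) \<Rightarrow> ('f, 'a) ualg \<Rightarrow> 'a \<Rightarrow> bool" where
  "is_idempotent ar A u \<longleftrightarrow> u \<in> carrier A \<and> (\<forall>f. oper A f (replicate (ar f) u) = u)"

text \<open>The term condition \<open>C(\<alpha>, \<beta>; \<delta>)\<close>. Terms have two disjoint blocks of variables, tagged by
  \<^const>\<open>Inl\<close> and \<^const>\<open>Inr\<close>; a term uses only finitely many of the entries of \<open>a, b, c, d\<close>.\<close>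

definition centralizes ::
  "('f \<Rightarrow> nat) \<Rightarrow> ('f, 'a) ualg \<Rightarrow> ('a \<times> 'a) set \<Rightarrow> ('a \<times> 'a) set \<Rightarrow> ('a \<times> 'a) set \<Rightarrow> bool" where
  "centralizes ar A \<alpha> \<beta> \<delta> \<longleftrightarrow>
     (\<forall>t \<in> terms ar (UNIV :: (nat + nat) set). \<forall>a b c d.
        (\<forall>i. (a i, b i) \<in> \<alpha>) \<longrightarrow> (\<forall>i. (c i, d i) \<in> \<beta>) \<longrightarrow>
        (eval A (case_sum a c) t, eval A (case_sum a d) t) \<in> \<delta> \<longrightarrow>
        (eval A (case_sum b c) t, eval A (case_sum b d) t) \<in> \<delta>)"

definition commutator ::
  "('f \<Rightarrow> nat) \<Rightarrow> ('f, 'a) ualg \<Rightarrow> ('a \<times> 'a) set \<Rightarrow> ('a \<times> 'a) set \<Rightarrow> ('a \<times> 'a) set" where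
  "commutator ar A \<alpha> \<beta> = \<Inter>{\<delta>. is_congruence ar A \<delta> \<and> centralizes ar A \<alpha> \<beta> \<delta>}"

definition central_extension ::
  "('f \<Rightarrow> nat) \<Rightarrow> ('f, 'a) ualg \<Rightarrow> ('f, 'q) ualg \<Rightarrow> ('a \<Rightarrow> 'q) \<Rightarrow> bool" where
  "central_extension ar A Q \<pi> \<longleftrightarrow> \<pi> \<in> alg_hom ar A Q \<and> \<pi> ` carrier A = carrier Q \<and>
     commutator ar A (ker_cong A \<pi>) (one_cong A) = zero_cong A"


section \<open>Varieties\<close>

text \<open>By Birkhoff's theorem a variety is the class of models of a set \<open>Eqs\<close> of identities in
  countably many variables.\<close>

definition is_identity_set :: "('f \<Rightarrow> nat) \<Rightarrow> (('f, nat) trm \<times> ('f, nat) trm) set \<Rightarrow> bool" where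
  "is_identity_set ar Eqs \<longleftrightarrow> Eqs \<subseteq> terms ar UNIV \<times> terms ar UNIV"

definition satisfies :: "('f, 'a) ualg \<Rightarrow> ('f, 'v) trm \<Rightarrow> ('f, 'v) trm \<Rightarrow> bool" where
  "satisfies A s t \<longleftrightarrow> (\<forall>\<rho>. (\<forall>x. \<rho> x \<in> carrier A) \<longrightarrow> eval A \<rho> s = eval A \<rho> t)"

definition in_variety ::
  "('f \<Rightarrow> nat) \<Rightarrow> (('f, nat) trm \<times> ('f, nat) trm) set \<Rightarrow> ('f, 'a) ualg \<Rightarrow> bool" where
  "in_variety ar Eqs A \<longleftrightarrow> is_algebra ar A \<and> (\<forall>(s, t) \<in> Eqs. satisfies A s t)"

text \<open>HOL cannot quantify over all types inside a formula, so statements about all members of the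
  variety quantify over the members whose elements are sets of terms in countably many variables.
  This loses nothing: the free algebra on countably many generators is among them. That identities
  (and the difference term condition) pass from these to members over arbitrary types is proved
  below in \<open>identities_hold\<close> (and \<open>difference_term_transfer\<close>).\<close>

type_synonym 'f small_alg = "('f, ('f, nat) trm set) ualg"

definition identities ::
  "('f \<Rightarrow> nat) \<Rightarrow> (('f, nat) trm \<times> ('f, nat) trm) set \<Rightarrow> 'v set \<Rightarrow> (('f, 'v) trm \<times> ('f, 'v) trm) set" where
  "identities ar Eqs X = {(s, t). s \<in> terms ar X \<and> t \<in> terms ar X \<and>
     (\<forall>A :: 'f small_alg. in_variety ar Eqs A \<longrightarrow> satisfies A s t)}"

definition difference_term ::
  "('f \<Rightarrow> nat) \<Rightarrow> (('f, nat) trm \<times> ('f, nat) trm) set \<Rightarrow> 'f \<Rightarrow> bool" where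
  "difference_term ar Eqs m \<longleftrightarrow> ar m = 3 \<and>
     (\<forall>A :: 'f small_alg. in_variety ar Eqs A \<longrightarrow>
        (\<forall>x \<in> carrier A. \<forall>y \<in> carrier A. oper A m [x, x, y] = y) \<and>
        (\<forall>\<alpha>. is_congruence ar A \<alpha> \<longrightarrow>
           (\<forall>(x, y) \<in> \<alpha>. (x, oper A m [x, y, y]) \<in> commutator ar A \<alpha> \<alpha>)))"

definition free_alg ::
  "('f \<Rightarrow> nat) \<Rightarrow> (('f, nat) trm \<times> ('f, nat) trm) set \<Rightarrow> 'x set \<Rightarrow> ('f, ('f, 'x) trm set) ualg" where
  "free_alg ar Eqs X = quot_alg \<lparr>carrier = terms ar X, oper = App\<rparr> (identities ar Eqs X)"

definition free_presentation ::
  "('f \<Rightarrow> nat) \<Rightarrow> (('f, nat) trm \<times> ('f, nat) trm) set \<Rightarrow> 'x set \<Rightarrow>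
   (('f, 'x) trm set \<times> ('f, 'x) trm set) set \<Rightarrow> ('f, 'q) ualg \<Rightarrow> bool" where
  "free_presentation ar Eqs X \<theta> Q \<longleftrightarrow> is_congruence ar (free_alg ar Eqs X) \<theta> \<and>
     alg_iso ar (quot_alg (free_alg ar Eqs X) \<theta>) Q \<noteq> {}"

subsection \<open>Independence of the choice of type\<close>

lemma eval_in_carrier:
  assumes "is_algebra ar A" "t \<in> terms ar X" "\<And>x. x \<in> X \<Longrightarrow> \<rho> x \<in> carrier A"
  shows "eval A \<rho> t \<in> carrier A"
  using assms(2)
proof induction
  case (terms_App ts f)
  then have "map (eval A \<rho>) ts \<in> tuples (ar f) (carrier A)"
    by (auto simp: tuples_def)
  then show ?case
    using assms(1) by (auto simp: is_algebra_def)
qed (use assms(3) in auto)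

lemma eval_alg_hom:
  assumes "is_algebra ar A" "g \<in> alg_hom ar A C" "t \<in> terms ar X"
    and "\<And>x. x \<in> X \<Longrightarrow> \<rho> x \<in> carrier A"
  shows "eval C (\<lambda>x. g (\<rho> x)) t = g (eval A \<rho> t)"
  using assms(3)
proof induction
  case (terms_App ts f)
  have "map (eval A \<rho>) ts \<in> tuples (ar f) (carrier A)"
    using terms_App eval_in_carrier[of ar A _ X \<rho>] assms(1,4) by (auto simp: tuples_def)
  then have "g (oper A f (map (eval A \<rho>) ts)) = oper C f (map g (map (eval A \<rho>) ts))"
    using assms(2) by (auto simp: alg_hom_def)
  moreover have "map (eval C (\<lambda>x. g (\<rho> x))) ts = map g (map (eval A \<rho>) ts)"
    using terms_App by auto
  ultimately show ?case by (simp only: eval.simps)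
qed auto

lemma eval_cong:
  assumes "\<And>x. x \<in> set2_trm t \<Longrightarrow> \<rho> x = \<rho>' x"
  shows "eval A \<rho> t = eval A \<rho>' t"
  using assms
proof (induction t)
  case (App f ts)
  then have "map (eval A \<rho>) ts = map (eval A \<rho>') ts" by auto
  then show ?case by (simp only: eval.simps)
qed auto

text \<open>Every countably generated subalgebra has a copy among the small algebras.\<close>

lemma small_copy:
  fixes A :: "('f, 'a) ualg" and \<sigma> :: "nat \<Rightarrow> 'a"
  assumes Eqs: "is_identity_set ar Eqs" and A: "in_variety ar Eqs A"
    and \<sigma>: "\<And>i. \<sigma> i \<in> carrier A"
  obtains A' :: "'f small_alg" and g
  where "in_variety ar Eqs A'" "g \<in> alg_hom ar A' A" "inj_on g (carrier A')"
    "range \<sigma> \<subseteq> g ` carrier A'"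
proof -
  define K where "K a = {t \<in> terms ar (UNIV :: nat set). eval A \<sigma> t = a}" for a
  define S where "S = eval A \<sigma> ` terms ar (UNIV :: nat set)"
  define g where "g C = eval A \<sigma> (SOME t. t \<in> C)" for C
  define A' :: "'f small_alg" where
    "A' = \<lparr>carrier = K ` S, oper = (\<lambda>f Cs. K (oper A f (map g Cs)))\<rparr>"
  have alg: "is_algebra ar A" using A by (simp add: in_variety_def)
  have SA: "S \<subseteq> carrier A"
    unfolding S_def using eval_in_carrier[OF alg] \<sigma> by blast
  have gK: "g (K a) = a" if "a \<in> S" for a
  proof -
    from that obtain t where "t \<in> K a" by (auto simp: S_def K_def)
    then have "(SOME t. t \<in> K a) \<in> K a" by (rule someI)
    then show ?thesis by (simp add: g_def K_def)
  qed
  have Sop: "oper A f xs \<in> S" if "xs \<in> tuples (ar f) S" for f xs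
  proof -
    have "\<forall>x \<in> set xs. \<exists>t \<in> terms ar (UNIV :: nat set). x = eval A \<sigma> t"
      using that by (auto simp: tuples_def S_def)
    then obtain T where T: "\<And>x. x \<in> set xs \<Longrightarrow>
        T x \<in> terms ar (UNIV :: nat set) \<and> x = eval A \<sigma> (T x)"
      by metis
    have "App f (map T xs) \<in> terms ar (UNIV :: nat set)"
      using T that by (auto intro!: terms_App simp: tuples_def)
    moreover have "map (\<lambda>x. eval A \<sigma> (T x)) xs = map id xs"
      by (rule map_cong) (use T in auto)
    then have "eval A \<sigma> (App f (map T xs)) = oper A f xs"
      by (simp add: comp_def)
    ultimately show ?thesis unfolding S_def by (metis image_eqI)
  qed
  have gS: "map g Cs \<in> tuples (ar f) S" if "Cs \<in> tuples (ar f) (carrier A')" for f Cs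
    using that gK by (fastforce simp: tuples_def A'_def)
  have "Var 0 \<in> terms ar (UNIV :: nat set)" by (auto intro: terms_Var)
  then have alg': "is_algebra ar A'"
    using Sop[OF gS] by (auto simp: is_algebra_def) (auto simp: A'_def S_def)
  have hom: "g \<in> alg_hom ar A' A"
    using gK SA gS Sop by (auto simp: alg_hom_def A'_def)
  have inj: "inj_on g (carrier A')"
    using gK by (auto simp: inj_on_def A'_def)
  have "satisfies A' s t" if "(s, t) \<in> Eqs" for s t
    unfolding satisfies_def
  proof (intro allI impI)
    fix \<rho> :: "nat \<Rightarrow> ('f, nat) trm set" assume \<rho>: "\<forall>x. \<rho> x \<in> carrier A'"
    have st: "s \<in> terms ar UNIV" "t \<in> terms ar UNIV"
      using that Eqs by (auto simp: is_identity_set_def)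
    have "\<forall>x. g (\<rho> x) \<in> carrier A" using \<rho> hom by (auto simp: alg_hom_def)
    then have "eval A (\<lambda>x. g (\<rho> x)) s = eval A (\<lambda>x. g (\<rho> x)) t"
      using A that by (auto simp: in_variety_def satisfies_def)
    then have "g (eval A' \<rho> s) = g (eval A' \<rho> t)"
      using eval_alg_hom[OF alg' hom] st \<rho> by metis
    then show "eval A' \<rho> s = eval A' \<rho> t"
      using inj eval_in_carrier[OF alg'] st \<rho> by (metis inj_onD)
  qed
  then have "in_variety ar Eqs A'" using alg' by (auto simp: in_variety_def)
  moreover have "\<sigma> i \<in> g ` carrier A'" for i
  proof -
    have "Var i \<in> terms ar (UNIV :: nat set)" by (auto intro: terms_Var)
    then have "\<sigma> i \<in> S" unfolding S_def by (metis eval.simps(1) image_eqI)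
    then show ?thesis using gK by (force simp: A'_def)
  qed
  ultimately show ?thesis using that hom inj by blast
qed

theorem identities_hold:
  fixes A :: "('f, 'a) ualg" and s t :: "('f, 'v) trm"
  assumes Eqs: "is_identity_set ar Eqs" and A: "in_variety ar Eqs A"
    and st: "(s, t) \<in> identities ar Eqs X"
  shows "satisfies A s t"
  unfolding satisfies_def
proof (intro allI impI)
  fix \<rho> :: "'v \<Rightarrow> 'a" assume \<rho>: "\<forall>x. \<rho> x \<in> carrier A"
  define V where "V = set2_trm s \<union> set2_trm t"
  have finite_vars: "finite (set2_trm u)" for u :: "('x, 'y) trm"
    by (induction u) auto
  obtain a where a: "a \<in> carrier A"
    using A by (auto simp: in_variety_def is_algebra_def)
  have "finite (\<rho> ` V)" using finite_vars by (auto simp: V_def)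
  then have "\<exists>xs. set xs = \<rho> ` V" by (rule finite_list)
  then obtain xs where xs: "set xs = \<rho> ` V" ..
  define \<sigma> where "\<sigma> = (\<lambda>i. if i < length xs then xs ! i else a)"
  have "x \<in> range \<sigma>" if "x \<in> set xs" for x
  proof -
    from that[unfolded in_set_conv_nth] obtain i where i: "i < length xs \<and> xs ! i = x" ..
    show ?thesis by (rule range_eqI[of _ _ i]) (simp add: \<sigma>_def i)
  qed
  moreover have "\<sigma> (length xs) = a" by (simp add: \<sigma>_def)
  then have "a \<in> range \<sigma>" by (rule range_eqI[OF sym])
  moreover have "range \<sigma> \<subseteq> insert a (set xs)" by (auto simp: \<sigma>_def)
  ultimately have \<sigma>: "range \<sigma> = insert a (\<rho> ` V)" unfolding xs[symmetric]
    by (intro equalityI) (simp_all add: subset_iff)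
  have \<sigma>A: "\<sigma> i \<in> carrier A" for i
    using rangeI[of \<sigma> i] a \<rho> unfolding \<sigma> by (auto simp del: rangeI)
  obtain A' :: "'f small_alg" and g where A': "in_variety ar Eqs A'" "g \<in> alg_hom ar A' A"
      "inj_on g (carrier A')" "range \<sigma> \<subseteq> g ` carrier A'"
    by (rule small_copy[OF Eqs A \<sigma>A])
  define \<rho>1 where "\<rho>1 x = (if x \<in> V then \<rho> x else a)" for x
  have "\<forall>x. \<exists>c \<in> carrier A'. g c = \<rho>1 x"
  proof
    fix x
    have "\<rho>1 x \<in> range \<sigma>" unfolding \<sigma> by (simp add: \<rho>1_def)
    then have "\<rho>1 x \<in> g ` carrier A'" using A'(4) by (rule rev_subsetD)
    then show "\<exists>c \<in> carrier A'. g c = \<rho>1 x" by (auto simp: image_iff)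
  qed
  then obtain \<rho>' where "\<forall>x. \<rho>' x \<in> carrier A' \<and> g (\<rho>' x) = \<rho>1 x"
    unfolding Bex_def by (elim choice[THEN exE])
  then have \<rho>': "\<rho>' x \<in> carrier A'" "g (\<rho>' x) = \<rho>1 x" for x by simp_all
  have "eval A' \<rho>' s = eval A' \<rho>' t"
    using st A'(1) \<rho>'(1) by (auto simp: identities_def satisfies_def)
  moreover have "is_algebra ar A'" using A' by (simp add: in_variety_def)
  then have "eval A \<rho>1 u = g (eval A' \<rho>' u)" if "u \<in> terms ar X" for u
    using eval_alg_hom[of ar A' g A u X \<rho>'] A'(2) that \<rho>' by simp
  ultimately have "eval A \<rho>1 s = eval A \<rho>1 t"
    using st by (auto simp: identities_def)
  moreover have "eval A \<rho> s = eval A \<rho>1 s" "eval A \<rho> t = eval A \<rho>1 t"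
    by (auto intro!: eval_cong simp: \<rho>1_def V_def)
  ultimately show "eval A \<rho> s = eval A \<rho> t" by simp
qed

lemma is_congruence_pullback:
  assumes alg: "is_algebra ar A'" and hom: "g \<in> alg_hom ar A' A" and \<theta>: "is_congruence ar A \<theta>"
  shows "is_congruence ar A' {(u, v). u \<in> carrier A' \<and> v \<in> carrier A' \<and> (g u, g v) \<in> \<theta>}"
    (is "is_congruence _ _ ?\<theta>'")
proof -
  have eq: "equiv (carrier A) \<theta>" using \<theta> by (simp add: is_congruence_def)
  have gc: "g u \<in> carrier A" if "u \<in> carrier A'" for u
    using hom that by (auto simp: alg_hom_def)
  have "equiv (carrier A') ?\<theta>'"
  proof (rule equivI)
    show "refl_on (carrier A') ?\<theta>'"
      using eq gc by (auto simp: refl_on_def equiv_def)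
    show "sym ?\<theta>'" using eq by (auto simp: sym_def equiv_def)
    show "trans ?\<theta>'" using eq by (auto simp: trans_def equiv_def) 
  qed auto
  moreover have "(oper A' f xs, oper A' f ys) \<in> ?\<theta>'"
    if "xs \<in> tuples (ar f) (carrier A')" "ys \<in> tuples (ar f) (carrier A')"
      "\<forall>i < ar f. (xs ! i, ys ! i) \<in> ?\<theta>'" for f xs ys
  proof -
    have "map g xs \<in> tuples (ar f) (carrier A)" "map g ys \<in> tuples (ar f) (carrier A)"
      using that gc by (auto simp: tuples_def)
    moreover have "\<forall>i < ar f. (map g xs ! i, map g ys ! i) \<in> \<theta>"
      using that by (auto simp: tuples_def)
    ultimately have "(oper A f (map g xs), oper A f (map g ys)) \<in> \<theta>"
      using \<theta> by (auto simp: is_congruence_def)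
    then show ?thesis
      using that hom alg by (auto simp: alg_hom_def is_algebra_def)
  qed
  ultimately show ?thesis by (auto simp: is_congruence_def)
qed

theorem difference_term_transfer:
  assumes Eqs: "is_identity_set ar Eqs" and A: "in_variety ar Eqs A"
    and m: "difference_term ar Eqs m"
  shows "\<And>x y. x \<in> carrier A \<Longrightarrow> y \<in> carrier A \<Longrightarrow> oper A m [x, x, y] = y"
    and "\<And>\<alpha> x y. is_congruence ar A \<alpha> \<Longrightarrow> (x, y) \<in> \<alpha> \<Longrightarrow>
      (x, oper A m [x, y, y]) \<in> commutator ar A \<alpha> \<alpha>"
proof -
  have copy: "\<exists>(A' :: 'a small_alg) g u v. in_variety ar Eqs A' \<and> g \<in> alg_hom ar A' A \<and>
      u \<in> carrier A' \<and> v \<in> carrier A' \<and> g u = x \<and> g v = y"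
    if xy: "x \<in> carrier A" "y \<in> carrier A" for x y
  proof -
    define \<sigma> where "\<sigma> i = (if i = (0::nat) then x else y)" for i
    have "\<sigma> i \<in> carrier A" for i using xy by (simp add: \<sigma>_def)
    then obtain A' :: "'a small_alg" and g where A': "in_variety ar Eqs A'"
      "g \<in> alg_hom ar A' A" "inj_on g (carrier A')" "range \<sigma> \<subseteq> g ` carrier A'"
      by (rule small_copy[OF Eqs A])
    have "\<sigma> 0 = x" "\<sigma> 1 = y" by (simp_all add: \<sigma>_def)
    then have "x \<in> g ` carrier A'" "y \<in> g ` carrier A'" using A'(4) by blast+
    then show ?thesis using A'(1,2) by blast
  qed
  have gm: "g (oper A' m [u, v, w]) = oper A m [g u, g v, g w]"
    if "g \<in> alg_hom ar A' A" "u \<in> carrier A'" "v \<in> carrier A'" "w \<in> carrier A'"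
    for A' :: "'a small_alg" and g u v w
  proof -
    have "[u, v, w] \<in> tuples (ar m) (carrier A')"
      using that m by (auto simp: tuples_def difference_term_def)
    then show ?thesis using that(1) by (force simp: alg_hom_def)
  qed
  show "oper A m [x, x, y] = y" if "x \<in> carrier A" "y \<in> carrier A" for x y
  proof -
    from copy[OF that] obtain A' :: "'a small_alg" and g u v where
      A': "in_variety ar Eqs A'" "g \<in> alg_hom ar A' A" "u \<in> carrier A'" "v \<in> carrier A'"
        "g u = x" "g v = y" by (elim exE conjE)
    have "oper A' m [u, u, v] = v"
      using m A'(1,3,4) by (simp add: difference_term_def)
    then show ?thesis using gm[OF A'(2,3,3,4)] A'(5,6) by simp
  qed
  show "(x, oper A m [x, y, y]) \<in> commutator ar A \<alpha> \<alpha>"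
    if \<alpha>: "is_congruence ar A \<alpha>" and xy: "(x, y) \<in> \<alpha>" for \<alpha> x y
    unfolding commutator_def
  proof (clarify)
    fix \<delta> assume \<delta>: "is_congruence ar A \<delta>" "centralizes ar A \<alpha> \<alpha> \<delta>"
    have "x \<in> carrier A" "y \<in> carrier A"
      using \<alpha> xy by (auto simp: is_congruence_def equiv_def)
    from copy[OF this] obtain A' :: "'a small_alg" and g u v where
      A': "in_variety ar Eqs A'" "g \<in> alg_hom ar A' A" "u \<in> carrier A'" "v \<in> carrier A'"
        "g u = x" "g v = y" by (elim exE conjE)
    have alg': "is_algebra ar A'" using A' by (simp add: in_variety_def)
    define pb where "pb \<theta> = {(u, v). u \<in> carrier A' \<and> v \<in> carrier A' \<and> (g u, g v) \<in> \<theta>}" for \<theta>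
    have pb: "is_congruence ar A' (pb \<theta>)" if "is_congruence ar A \<theta>" for \<theta>
      unfolding pb_def by (rule is_congruence_pullback[OF alg' A'(2) that])
    have "centralizes ar A' (pb \<alpha>) (pb \<alpha>) (pb \<delta>)"
      unfolding centralizes_def
    proof (intro ballI allI impI)
      fix t :: "('a, nat + nat) trm" and a b c d
      assume t: "t \<in> terms ar UNIV" and ab: "\<forall>i. (a i, b i) \<in> pb \<alpha>"
        and cd: "\<forall>i. (c i, d i) \<in> pb \<alpha>"
        and h: "(eval A' (case_sum a c) t, eval A' (case_sum a d) t) \<in> pb \<delta>"
      have ev: "eval A (case_sum (\<lambda>i. g (p i)) (\<lambda>i. g (q i))) t = g (eval A' (case_sum p q) t)"
        and evc: "eval A' (case_sum p q) t \<in> carrier A'"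
        if "\<forall>i. p i \<in> carrier A'" "\<forall>i. q i \<in> carrier A'" for p q
      proof -
        have *: "case_sum p q z \<in> carrier A'" for z using that by (cases z) auto
        have "(\<lambda>z. g (case_sum p q z)) = case_sum (\<lambda>i. g (p i)) (\<lambda>i. g (q i))"
          by (auto split: sum.split)
        then show "eval A (case_sum (\<lambda>i. g (p i)) (\<lambda>i. g (q i))) t = g (eval A' (case_sum p q) t)"
          using eval_alg_hom[where X = UNIV and \<rho> = "case_sum p q", OF alg' A'(2) t *] by simp
        show "eval A' (case_sum p q) t \<in> carrier A'"
          using eval_in_carrier[where X = UNIV and \<rho> = "case_sum p q", OF alg' t *] .
      qed
      have car: "\<forall>i. a i \<in> carrier A'" "\<forall>i. b i \<in> carrier A'" "\<forall>i. c i \<in> carrier A'"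
          "\<forall>i. d i \<in> carrier A'"
        using ab cd by (auto simp: pb_def)
      let ?g = "\<lambda>p i. g (p i)"
      have "\<forall>i. (?g a i, ?g b i) \<in> \<alpha>" "\<forall>i. (?g c i, ?g d i) \<in> \<alpha>"
        using ab cd by (auto simp: pb_def)
      moreover have "(eval A (case_sum (?g a) (?g c)) t, eval A (case_sum (?g a) (?g d)) t) \<in> \<delta>"
        using h ev car by (simp add: pb_def)
      ultimately have "(eval A (case_sum (?g b) (?g c)) t, eval A (case_sum (?g b) (?g d)) t) \<in> \<delta>"
        by (rule \<delta>(2)[unfolded centralizes_def, THEN bspec, OF t, THEN spec, THEN spec,
              THEN spec, THEN spec, THEN mp, THEN mp, THEN mp])
      then show "(eval A' (case_sum b c) t, eval A' (case_sum b d) t) \<in> pb \<delta>"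
        using ev evc car by (simp add: pb_def)
    qed
    moreover have "(u, v) \<in> pb \<alpha>" using xy A' by (simp add: pb_def)
    then have "(u, oper A' m [u, v, v]) \<in> commutator ar A' (pb \<alpha>) (pb \<alpha>)"
      using m A'(1) pb[OF \<alpha>] unfolding difference_term_def by blast
    ultimately have "(u, oper A' m [u, v, v]) \<in> pb \<delta>"
      using pb[OF \<delta>(1)] by (auto simp: commutator_def)
    then show "(x, oper A m [x, y, y]) \<in> \<delta>"
      using gm[OF A'(2)] A' by (simp add: pb_def)
  qed
qed


section \<open>Kernel algebras\<close>

text \<open>The library's locale \<^locale>\<open>module\<close> requires a commutative ring of scalars.\<close>

locale left_module = R?: ring R + M?: abelian_group M for R (structure) and M (structure) +
  assumes smult_closed: "\<lbrakk>a \<in> carrier R; x \<in> carrier M\<rbrakk> \<Longrightarrow> a \<odot>\<^bsub>M\<^esub> x \<in> carrier M"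
    and smult_l_distr: "\<lbrakk>a \<in> carrier R; b \<in> carrier R; x \<in> carrier M\<rbrakk> \<Longrightarrow>
      (a \<oplus>\<^bsub>R\<^esub> b) \<odot>\<^bsub>M\<^esub> x = a \<odot>\<^bsub>M\<^esub> x \<oplus>\<^bsub>M\<^esub> b \<odot>\<^bsub>M\<^esub> x"
    and smult_r_distr: "\<lbrakk>a \<in> carrier R; x \<in> carrier M; y \<in> carrier M\<rbrakk> \<Longrightarrow>
      a \<odot>\<^bsub>M\<^esub> (x \<oplus>\<^bsub>M\<^esub> y) = a \<odot>\<^bsub>M\<^esub> x \<oplus>\<^bsub>M\<^esub> a \<odot>\<^bsub>M\<^esub> y"
    and smult_assoc1: "\<lbrakk>a \<in> carrier R; b \<in> carrier R; x \<in> carrier M\<rbrakk> \<Longrightarrow>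
      (a \<otimes>\<^bsub>R\<^esub> b) \<odot>\<^bsub>M\<^esub> x = a \<odot>\<^bsub>M\<^esub> (b \<odot>\<^bsub>M\<^esub> x)"
    and smult_one: "x \<in> carrier M \<Longrightarrow> \<one>\<^bsub>R\<^esub> \<odot>\<^bsub>M\<^esub> x = x"

text \<open>A kernel algebra is a module together with a family of operations on its carrier;
  \<open>alg\<close> forgets the module structure.\<close>

record ('r, 'b, 'f) kernel_alg = "('r, 'b) module" +
  kop :: "'f \<Rightarrow> 'b list \<Rightarrow> 'b"

definition alg :: "('r, 'b, 'f) kernel_alg \<Rightarrow> ('f, 'b) ualg" where
  "alg B = \<lparr>carrier = carrier B, oper = kop B\<rparr>"

definition is_kernel_alg ::
  "('f \<Rightarrow> nat) \<Rightarrow> 'f \<Rightarrow> 'r ring \<Rightarrow> ('r, 'b, 'f) kernel_alg \<Rightarrow> bool" where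
  "is_kernel_alg ar m R B \<longleftrightarrow> left_module R B \<and>
     (\<forall>f. \<exists>r \<in> {..<ar f} \<rightarrow> carrier R. \<forall>xs \<in> tuples (ar f) (carrier B).
        kop B f xs = (\<Oplus>\<^bsub>B\<^esub> i \<in> {..<ar f}. r i \<odot>\<^bsub>B\<^esub> (xs ! i))) \<and>
     (\<forall>x \<in> carrier B. \<forall>y \<in> carrier B. \<forall>z \<in> carrier B.
        kop B m [x, y, z] = x \<ominus>\<^bsub>B\<^esub> y \<oplus>\<^bsub>B\<^esub> z)"

definition central_datum ::
  "('f \<Rightarrow> nat) \<Rightarrow> (('f, nat) trm \<times> ('f, nat) trm) set \<Rightarrow> 'f \<Rightarrow> ('f, 'q) ualg \<Rightarrow>
   'r ring \<Rightarrow> ('r, 'b, 'f) kernel_alg \<Rightarrow> bool" where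
  "central_datum ar Eqs m Q R B \<longleftrightarrow>
     is_kernel_alg ar m R B \<and> in_variety ar Eqs (alg B) \<and> in_variety ar Eqs Q"


section \<open>Cocycles and the second cohomology group\<close>

text \<open>Families of functions are taken extensional (\<^const>\<open>undefined\<close> outside their domain), so that
  equality of cocycles is equality in HOL.\<close>

definition cocycles ::
  "('f \<Rightarrow> nat) \<Rightarrow> ('f, 'q) ualg \<Rightarrow> ('r, 'b, 'f) kernel_alg \<Rightarrow> ('f \<Rightarrow> 'q list \<Rightarrow> 'b) set" where
  "cocycles ar Q B = {T. \<forall>f. T f \<in> tuples (ar f) (carrier Q) \<rightarrow>\<^sub>E carrier B}"

definition twisted_alg ::
  "('r, 'b, 'f) kernel_alg \<Rightarrow> ('f \<Rightarrow> 'q list \<Rightarrow> 'b) \<Rightarrow> ('f, 'q) ualg \<Rightarrow> ('f, 'b \<times> 'q) ualg" where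
  "twisted_alg B T Q = \<lparr>carrier = carrier B \<times> carrier Q,
     oper = (\<lambda>f xs. (kop B f (map fst xs) \<oplus>\<^bsub>B\<^esub> T f (map snd xs), oper Q f (map snd xs)))\<rparr>"

primrec dterm ::
  "('r, 'b, 'f) kernel_alg \<Rightarrow> ('f \<Rightarrow> 'q list \<Rightarrow> 'b) \<Rightarrow> ('f, 'q) ualg \<Rightarrow> ('v \<Rightarrow> 'q) \<Rightarrow> ('f, 'v) trm \<Rightarrow> 'b" where
  "dterm B T Q \<rho> (Var x) = \<zero>\<^bsub>B\<^esub>"
| "dterm B T Q \<rho> (App f ts) = kop B f (map (dterm B T Q \<rho>) ts) \<oplus>\<^bsub>B\<^esub> T f (map (eval Q \<rho>) ts)"

definition is_compatible ::
  "('f \<Rightarrow> nat) \<Rightarrow> (('f, nat) trm \<times> ('f, nat) trm) set \<Rightarrow> ('f, 'q) ualg \<Rightarrow>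
   ('r, 'b, 'f) kernel_alg \<Rightarrow> ('f \<Rightarrow> 'q list \<Rightarrow> 'b) \<Rightarrow> bool" where
  "is_compatible ar Eqs Q B T \<longleftrightarrow> (\<forall>(s, t) \<in> identities ar Eqs (UNIV :: nat set).
     \<forall>\<rho>. (\<forall>x. \<rho> x \<in> carrier Q) \<longrightarrow> dterm B T Q \<rho> s = dterm B T Q \<rho> t)"

definition coboundaries ::
  "('f \<Rightarrow> nat) \<Rightarrow> ('f, 'q) ualg \<Rightarrow> ('r, 'b, 'f) kernel_alg \<Rightarrow> ('f \<Rightarrow> 'q list \<Rightarrow> 'b) set" where
  "coboundaries ar Q B = {G. \<exists>h \<in> carrier Q \<rightarrow> carrier B.
     G = (\<lambda>f. \<lambda>qs \<in> tuples (ar f) (carrier Q). kop B f (map h qs) \<ominus>\<^bsub>B\<^esub> h (oper Q f qs))}"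

definition Z2_group ::
  "('f \<Rightarrow> nat) \<Rightarrow> (('f, nat) trm \<times> ('f, nat) trm) set \<Rightarrow> ('f, 'q) ualg \<Rightarrow>
   ('r, 'b, 'f) kernel_alg \<Rightarrow> ('f \<Rightarrow> 'q list \<Rightarrow> 'b) monoid" where
  "Z2_group ar Eqs Q B = \<lparr>carrier = {T \<in> cocycles ar Q B. is_compatible ar Eqs Q B T},
     mult = (\<lambda>S T f. \<lambda>qs \<in> tuples (ar f) (carrier Q). S f qs \<oplus>\<^bsub>B\<^esub> T f qs),
     one = (\<lambda>f. \<lambda>qs \<in> tuples (ar f) (carrier Q). \<zero>\<^bsub>B\<^esub>)\<rparr>"

definition H2_group ::
  "('f \<Rightarrow> nat) \<Rightarrow> (('f, nat) trm \<times> ('f, nat) trm) set \<Rightarrow> ('f, 'q) ualg \<Rightarrow>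
   ('r, 'b, 'f) kernel_alg \<Rightarrow> ('f \<Rightarrow> 'q list \<Rightarrow> 'b) set monoid" where
  "H2_group ar Eqs Q B = Z2_group ar Eqs Q B Mod coboundaries ar Q B"

definition H2_class ::
  "('f \<Rightarrow> nat) \<Rightarrow> (('f, nat) trm \<times> ('f, nat) trm) set \<Rightarrow> ('f, 'q) ualg \<Rightarrow>
   ('r, 'b, 'f) kernel_alg \<Rightarrow> ('f \<Rightarrow> 'q list \<Rightarrow> 'b) \<Rightarrow> ('f \<Rightarrow> 'q list \<Rightarrow> 'b) set" where
  "H2_class ar Eqs Q B T = coboundaries ar Q B #>\<^bsub>Z2_group ar Eqs Q B\<^esub> T"

text \<open>\<open>\<pi> : A \<rightarrow> Q\<close> realizes \<open>(Q, B)\<close> and is represented by \<open>[T]\<close>, through the isomorphism \<open>\<psi>\<close>.\<close>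

definition realizes_via ::
  "('f \<Rightarrow> nat) \<Rightarrow> (('f, nat) trm \<times> ('f, nat) trm) set \<Rightarrow> ('f, 'a) ualg \<Rightarrow> ('f, 'q) ualg \<Rightarrow>
   ('a \<Rightarrow> 'q) \<Rightarrow> ('r, 'b, 'f) kernel_alg \<Rightarrow> ('f \<Rightarrow> 'q list \<Rightarrow> 'b) \<Rightarrow> ('a \<Rightarrow> 'b \<times> 'q) \<Rightarrow> bool" where
  "realizes_via ar Eqs A Q \<pi> B T \<psi> \<longleftrightarrow>
     T \<in> cocycles ar Q B \<and> is_compatible ar Eqs Q B T \<and>
     \<psi> \<in> alg_iso ar A (twisted_alg B T Q) \<and> (\<forall>a \<in> carrier A. snd (\<psi> a) = \<pi> a)"


section \<open>Hom groups and the maps of the sequence\<close>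

definition Hom_group ::
  "('f \<Rightarrow> nat) \<Rightarrow> ('f, 'a) ualg \<Rightarrow> ('s, 'e, 'f) kernel_alg \<Rightarrow> ('a \<Rightarrow> 'e) monoid" where
  "Hom_group ar A E = \<lparr>carrier = alg_hom ar A (alg E) \<inter> extensional (carrier A),
     mult = (\<lambda>\<phi> \<chi>. \<lambda>a \<in> carrier A. \<phi> a \<oplus>\<^bsub>E\<^esub> \<chi> a),
     one = (\<lambda>a \<in> carrier A. \<zero>\<^bsub>E\<^esub>)\<rparr>"

definition Hom0_group ::
  "('f \<Rightarrow> nat) \<Rightarrow> ('r, 'b, 'f) kernel_alg \<Rightarrow> ('s, 'e, 'f) kernel_alg \<Rightarrow> ('b \<Rightarrow> 'e) monoid" where
  "Hom0_group ar B E = (Hom_group ar (alg B) E)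
     \<lparr>carrier := {\<phi> \<in> carrier (Hom_group ar (alg B) E). \<phi> \<zero>\<^bsub>B\<^esub> = \<zero>\<^bsub>E\<^esub>}\<rparr>"

definition infl_Hom :: "('f, 'a) ualg \<Rightarrow> ('a \<Rightarrow> 'q) \<Rightarrow> ('q \<Rightarrow> 'e) \<Rightarrow> 'a \<Rightarrow> 'e" where
  "infl_Hom A \<pi> \<phi> = (\<lambda>a \<in> carrier A. \<phi> (\<pi> a))"

text \<open>Under the identification \<open>\<psi>\<close> of \<open>A\<close> with the twisted algebra, the common value of
  \<open>\<phi>(b, q) - \<phi>(0, q)\<close> over all \<open>q\<close>.\<close>

definition restr ::
  "('f, 'a) ualg \<Rightarrow> ('f, 'q) ualg \<Rightarrow> ('a \<Rightarrow> 'b \<times> 'q) \<Rightarrow> ('r, 'b, 'f) kernel_alg \<Rightarrow>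
   ('s, 'e, 'f) kernel_alg \<Rightarrow> ('a \<Rightarrow> 'e) \<Rightarrow> 'b \<Rightarrow> 'e" where
  "restr A Q \<psi> B E \<phi> = (\<lambda>b \<in> carrier B. THE e. \<forall>q \<in> carrier Q.
     e = \<phi> (inv_into (carrier A) \<psi> (b, q)) \<ominus>\<^bsub>E\<^esub> \<phi> (inv_into (carrier A) \<psi> (\<zero>\<^bsub>B\<^esub>, q)))"

definition transgr ::
  "('f \<Rightarrow> nat) \<Rightarrow> (('f, nat) trm \<times> ('f, nat) trm) set \<Rightarrow> ('f, 'q) ualg \<Rightarrow> ('s, 'e, 'f) kernel_alg \<Rightarrow>
   ('f \<Rightarrow> 'q list \<Rightarrow> 'b) \<Rightarrow> ('b \<Rightarrow> 'e) \<Rightarrow> ('f \<Rightarrow> 'q list \<Rightarrow> 'e) set" where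
  "transgr ar Eqs Q E T \<phi> =
     H2_class ar Eqs Q E (\<lambda>f. \<lambda>qs \<in> tuples (ar f) (carrier Q). \<phi> (T f qs))"

text \<open>The union over all representatives is a single class exactly if \<open>[S] \<mapsto> [S \<circ> \<pi>]\<close> is
  well defined.\<close>

definition infl_H2 ::
  "('f \<Rightarrow> nat) \<Rightarrow> (('f, nat) trm \<times> ('f, nat) trm) set \<Rightarrow> ('f, 'a) ualg \<Rightarrow> ('a \<Rightarrow> 'q) \<Rightarrow>
   ('s, 'e, 'f) kernel_alg \<Rightarrow> ('f \<Rightarrow> 'q list \<Rightarrow> 'e) set \<Rightarrow> ('f \<Rightarrow> 'a list \<Rightarrow> 'e) set" where
  "infl_H2 ar Eqs A \<pi> E C = (\<Union>S \<in> C. H2_class ar Eqs A E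
     (\<lambda>f. \<lambda>as \<in> tuples (ar f) (carrier A). S f (map \<pi> as)))"

end

theory Submission
  imports Defs
begin

text \<open>Write elements of \<open>A\<close> in coordinates \<open>(\<beta> a, \<pi> a)\<close>. The identity \<open>m(x,x,y) = y\<close> forces
  \<open>T\<^sub>m(q,q,q') = 0\<close>, so \<open>m((b,q),(0,q),(b',q')) = (b + b',q')\<close>. If \<open>h : A \<rightarrow> E\<close> has a coboundary of the
  form \<open>S \<circ> \<pi>\<close> with \<open>S\<close> a compatible cocycle, then \<open>S\<^sub>m(q,q,q') = 0\<close> as well, and evaluating \<open>h\<close> on
  this identity splits it as \<open>h = \<phi> \<circ> \<beta> + k \<circ> \<pi>\<close> with \<open>\<phi>\<close> additive. Since \<open>S \<circ> \<pi>\<close> does not depend on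
  the first coordinate, \<open>\<phi>\<close> is a homomorphism \<open>B \<rightarrow> E\<close> and \<open>S = \<partial>k - \<phi> \<circ> T\<close>. For \<open>S = 0\<close> this is
  exactness at \<open>Hom(A, E)\<close> and half of exactness at \<open>Hom(B, E)\<close>; for general \<open>S\<close> it exhibits the kernel of
  inflation on cohomology as the image of transgression. The other inclusions come from the
  converse computation of the coboundary of \<open>\<phi> \<circ> \<beta> + k \<circ> \<pi>\<close>.\<close>

section \<open>Kernel algebras and cohomology groups\<close>

lemma tuples_map: "xs \<in> tuples n S \<Longrightarrow> (\<And>x. x \<in> S \<Longrightarrow> g x \<in> U) \<Longrightarrow> map g xs \<in> tuples n U"
  by (auto simp: tuples_def)

lemma map_restrict_tuple: "xs \<in> tuples n S \<Longrightarrow> map (\<lambda>x\<in>S. g x) xs = map g xs"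
  by (auto simp: tuples_def)

lemma oper_closed: "is_algebra ar A \<Longrightarrow> xs \<in> tuples (ar f) (carrier A) \<Longrightarrow> oper A f xs \<in> carrier A"
  by (auto simp: is_algebra_def)

lemma alg_hom_restrict:
  assumes "is_algebra ar A" "\<And>a. a \<in> carrier A \<Longrightarrow> g a \<in> carrier C"
    and "\<And>f xs. xs \<in> tuples (ar f) (carrier A) \<Longrightarrow> g (oper A f xs) = oper C f (map g xs)"
  shows "(\<lambda>a\<in>carrier A. g a) \<in> alg_hom ar A C"
  using assms by (auto simp: alg_hom_def map_restrict_tuple oper_closed simp del: map_eq_conv)

lemma in_variety_algebra: "in_variety ar Eqs A \<Longrightarrow> is_algebra ar A"
  by (simp add: in_variety_def)

lemma eval_tuple:
  assumes "is_algebra ar A" "App f ts \<in> terms ar UNIV" "\<And>x. \<rho> x \<in> carrier A"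
  shows "map (eval A \<rho>) ts \<in> tuples (ar f) (carrier A)"
proof -
  from assms(2) have "length ts = ar f" "\<forall>t\<in>set ts. t \<in> terms ar UNIV"
    by (auto elim: terms.cases)
  then show ?thesis using eval_in_carrier[OF assms(1), where X = UNIV and \<rho> = \<rho>] assms(3) by (auto simp: tuples_def)
qed

section \<open>Linearity of the operations of a kernel algebra\<close>

locale kernel_algebra =
  fixes ar :: "'f \<Rightarrow> nat" and m :: 'f and R :: "'r ring" and E :: "('r, 'e, 'f) kernel_alg" (structure)
  assumes kernel_alg: "is_kernel_alg ar m R E"

sublocale kernel_algebra \<subseteq> left_module R E
  using kernel_alg by (simp add: is_kernel_alg_def)

context kernel_algebra
begin

lemma kop_m:
  "x \<in> carrier E \<Longrightarrow> y \<in> carrier E \<Longrightarrow> z \<in> carrier E \<Longrightarrow> kop E m [x, y, z] = x \<ominus> y \<oplus> z"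
  using kernel_alg by (simp add: is_kernel_alg_def)

lemma kop_linear:
  obtains r where "r \<in> {..<ar f} \<rightarrow> carrier R"
    "\<And>xs. xs \<in> tuples (ar f) (carrier E) \<Longrightarrow> kop E f xs = (\<Oplus>i\<in>{..<ar f}. r i \<odot>\<^bsub>E\<^esub> (xs ! i))"
  using kernel_alg unfolding is_kernel_alg_def by metis

lemma kop_closed: "xs \<in> tuples (ar f) (carrier E) \<Longrightarrow> kop E f xs \<in> carrier E"
proof -
  assume xs: "xs \<in> tuples (ar f) (carrier E)"
  obtain r where r: "r \<in> {..<ar f} \<rightarrow> carrier R"
    "kop E f xs = (\<Oplus>i\<in>{..<ar f}. r i \<odot>\<^bsub>E\<^esub> (xs ! i))"
    by (metis kop_linear xs)
  show ?thesis unfolding r(2)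
    using r(1) xs by (intro M.finsum_closed) (auto simp: tuples_def intro!: smult_closed)
qed

lemma kop_map_closed:
  assumes "xs \<in> tuples (ar f) X" "\<And>x. x \<in> X \<Longrightarrow> g x \<in> carrier E"
  shows "kop E f (map g xs) \<in> carrier E"
  using assms by (intro kop_closed tuples_map)

text \<open>A linear combination of the arguments distributes over sums entry by entry. The entries
  are given as functions on a list over an arbitrary set \<open>X\<close>, so that they can later be
  indexed by elements of \<open>A\<close>, by elements of \<open>Q\<close> or by terms.\<close>

lemma kop_add:
  assumes xs: "xs \<in> tuples (ar f) X"
    and g: "\<And>x. x \<in> X \<Longrightarrow> g x \<in> carrier E" and h: "\<And>x. x \<in> X \<Longrightarrow> h x \<in> carrier E"
  shows "kop E f (map (\<lambda>x. g x \<oplus> h x) xs) = kop E f (map g xs) \<oplus> kop E f (map h xs)"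
proof -
  obtain r where r: "r \<in> {..<ar f} \<rightarrow> carrier R"
    "\<And>xs. xs \<in> tuples (ar f) (carrier E) \<Longrightarrow> kop E f xs = (\<Oplus>i\<in>{..<ar f}. r i \<odot>\<^bsub>E\<^esub> (xs ! i))"
    by (rule kop_linear[where f = f]) (rule that)
  have nth: "xs ! i \<in> X" "i < length xs" if "i < ar f" for i
    using that xs by (auto simp: tuples_def)
  have "kop E f (map (\<lambda>x. g x \<oplus> h x) xs) =
      (\<Oplus>i\<in>{..<ar f}. r i \<odot>\<^bsub>E\<^esub> (map g xs ! i) \<oplus> r i \<odot>\<^bsub>E\<^esub> (map h xs ! i))"
    using r(1) nth g h
    by (subst r(2)[OF tuples_map[OF xs]])
       (auto intro!: M.finsum_cong' M.add.m_closed smult_closed simp: smult_r_distr Pi_iff)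
  also have "\<dots> = kop E f (map g xs) \<oplus> kop E f (map h xs)"
    using r(1) nth g h
    by (subst M.finsum_addf)
       (auto intro!: smult_closed simp: Pi_iff r(2)[OF tuples_map[OF xs]])
  finally show ?thesis .
qed

lemma kop_zero:
  assumes "xs \<in> tuples (ar f) X"
  shows "kop E f (map (\<lambda>x. \<zero>) xs) = \<zero>"
proof -
  \<comment> \<open>The value at the zero tuple equals its own double, which in a group forces it to
    be zero.\<close>
  have "kop E f (map (\<lambda>x. \<zero>) xs) \<oplus> kop E f (map (\<lambda>x. \<zero>) xs) = kop E f (map (\<lambda>x. \<zero>) xs)"
    using kop_add[OF assms, of "\<lambda>_. \<zero>" "\<lambda>_. \<zero>"] by simp
  then show ?thesis
    using kop_map_closed[OF assms, of "\<lambda>_. \<zero>"] M.add.r_cancel_one by blast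
qed

lemma kop_uminus:
  assumes xs: "xs \<in> tuples (ar f) X" and g: "\<And>x. x \<in> X \<Longrightarrow> g x \<in> carrier E"
  shows "kop E f (map (\<lambda>x. \<ominus> g x) xs) = \<ominus> kop E f (map g xs)"
proof -
  have "kop E f (map (\<lambda>x. \<ominus> g x) xs) \<oplus> kop E f (map g xs) = kop E f (map (\<lambda>x. \<ominus> g x \<oplus> g x) xs)"
    by (rule kop_add[OF xs, symmetric]) (auto simp: g)
  also have "\<dots> = kop E f (map (\<lambda>x. \<zero>) xs)"
    by (rule arg_cong[where f = "kop E f"], rule map_cong) (use xs g in \<open>auto simp: tuples_def M.l_neg\<close>)
  also have "\<dots> = \<zero>" by (rule kop_zero[OF xs])
  finally show ?thesis
    using kop_map_closed[OF xs] g by (intro M.minus_equality[symmetric]) auto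
qed

lemma minus_add_add:
  "a \<in> carrier E \<Longrightarrow> b \<in> carrier E \<Longrightarrow> c \<in> carrier E \<Longrightarrow> d \<in> carrier E \<Longrightarrow>
   (a \<oplus> b) \<ominus> (c \<oplus> d) = (a \<ominus> c) \<oplus> (b \<ominus> d)"
  by (simp add: a_minus_def M.minus_add M.a_ac)

lemma uminus_zero: "\<ominus> \<zero> = \<zero>"
  by (rule M.minus_equality) auto

lemma minus_eq_zeroD:
  assumes "a \<in> carrier E" "b \<in> carrier E" "a \<ominus> b = \<zero>"
  shows "a = b"
proof -
  have "a = (a \<ominus> b) \<oplus> b" using assms(1,2) by (simp add: a_minus_def M.a_assoc M.l_neg)
  then show ?thesis using assms by simp
qed

lemma minus_add_minus:
  "a \<in> carrier E \<Longrightarrow> b \<in> carrier E \<Longrightarrow> c \<in> carrier E \<Longrightarrow> (a \<ominus> b) \<oplus> (b \<ominus> c) = a \<ominus> c"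
  by (simp add: a_minus_def M.a_assoc M.r_neg1 M.r_neg2)

text \<open>The cancellation needed in \<open>split_cobounding\<close>: \<open>x\<close> stands for
  the contribution of the kernel coordinate, which drops out, while \<open>w\<close> stands for the
  cocycle value.\<close>

lemma add_minus_add_cancel:
  assumes "x \<in> carrier E" "y \<in> carrier E" "w \<in> carrier E" "z \<in> carrier E"
  shows "(x \<oplus> y) \<ominus> (x \<oplus> (w \<oplus> z)) = (y \<ominus> z) \<ominus> w"
proof -
  have "(x \<oplus> y) \<ominus> (x \<oplus> (w \<oplus> z)) = (x \<ominus> x) \<oplus> (y \<ominus> (w \<oplus> z))"
    using assms by (simp add: minus_add_add)
  also have "\<dots> = y \<oplus> (\<ominus> w \<oplus> \<ominus> z)"
    using assms by (simp add: a_minus_def M.r_neg M.minus_add)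
  also have "\<dots> = (y \<ominus> z) \<ominus> w"
    using assms by (simp add: a_minus_def M.a_assoc M.a_comm[of "\<ominus> w" "\<ominus> z"])
  finally show ?thesis .
qed

section \<open>Groups of homomorphisms into a kernel algebra\<close>

lemma alg_hom_alg_iff:
  "g \<in> alg_hom ar A (alg E) \<longleftrightarrow> (\<forall>a\<in>carrier A. g a \<in> carrier E) \<and>
     (\<forall>f. \<forall>xs\<in>tuples (ar f) (carrier A). g (oper A f xs) = kop E f (map g xs))"
  by (auto simp: alg_hom_def alg_def)

lemma alg_homI:
  assumes "is_algebra ar A" "\<And>a. a \<in> carrier A \<Longrightarrow> g a \<in> carrier E"
    and "\<And>f xs. xs \<in> tuples (ar f) (carrier A) \<Longrightarrow> g (oper A f xs) = kop E f (map g xs)"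
  shows "(\<lambda>a\<in>carrier A. g a) \<in> carrier (Hom_group ar A E)"
  using alg_hom_restrict[of ar A g "alg E"] assms by (auto simp: Hom_group_def alg_def)

lemma Hom_groupD:
  assumes "g \<in> carrier (Hom_group ar A E)"
  shows "a \<in> carrier A \<Longrightarrow> g a \<in> carrier E"
    and "xs \<in> tuples (ar f) (carrier A) \<Longrightarrow> g (oper A f xs) = kop E f (map g xs)"
    and "g \<in> extensional (carrier A)"
  using assms by (auto simp: Hom_group_def alg_hom_alg_iff)

lemma Hom_group_simps:
  "mult (Hom_group ar A E) = (\<lambda>\<phi> \<chi>. \<lambda>a\<in>carrier A. \<phi> a \<oplus> \<chi> a)"
  "one (Hom_group ar A E) = (\<lambda>a\<in>carrier A. \<zero>)"
  by (simp_all add: Hom_group_def)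

lemma Hom_group_eqI:
  assumes "g \<in> carrier (Hom_group ar A E)" "h \<in> carrier (Hom_group ar A E)"
    and "\<And>a. a \<in> carrier A \<Longrightarrow> g a = h a"
  shows "g = h"
  using assms Hom_groupD(3) by (metis extensionalityI)

lemma comm_group_Hom_group:
  assumes A: "is_algebra ar A"
  shows "comm_group (Hom_group ar A E)"
proof (rule comm_groupI)
  let ?H = "Hom_group ar A E"
  show mc: "x \<otimes>\<^bsub>?H\<^esub> y \<in> carrier ?H" if "x \<in> carrier ?H" "y \<in> carrier ?H" for x y
    unfolding Hom_group_simps
    using that by (intro alg_homI[OF A]) (auto simp: Hom_groupD kop_add[where X = "carrier A"])
  show oc: "\<one>\<^bsub>?H\<^esub> \<in> carrier ?H"
    unfolding Hom_group_simps by (intro alg_homI[OF A]) (auto simp: kop_zero)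
  show "x \<otimes>\<^bsub>?H\<^esub> y \<otimes>\<^bsub>?H\<^esub> z = x \<otimes>\<^bsub>?H\<^esub> (y \<otimes>\<^bsub>?H\<^esub> z)"
    if "x \<in> carrier ?H" "y \<in> carrier ?H" "z \<in> carrier ?H" for x y z
    using that by (auto simp: Hom_group_simps Hom_groupD M.a_ac intro!: restrict_ext)
  show "x \<otimes>\<^bsub>?H\<^esub> y = y \<otimes>\<^bsub>?H\<^esub> x" if "x \<in> carrier ?H" "y \<in> carrier ?H" for x y
    using that by (auto simp: Hom_group_simps Hom_groupD M.a_ac intro!: restrict_ext)
  show "\<one>\<^bsub>?H\<^esub> \<otimes>\<^bsub>?H\<^esub> x = x" if "x \<in> carrier ?H" for x
    by (rule Hom_group_eqI[OF mc[OF oc that] that]) (use that in \<open>auto simp: Hom_group_simps Hom_groupD\<close>)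
  show "\<exists>y\<in>carrier ?H. y \<otimes>\<^bsub>?H\<^esub> x = \<one>\<^bsub>?H\<^esub>" if x: "x \<in> carrier ?H" for x
  proof
    show "(\<lambda>a\<in>carrier A. \<ominus> x a) \<in> carrier ?H"
      using x by (intro alg_homI[OF A]) (auto simp: Hom_groupD kop_uminus[where X = "carrier A"])
    show "(\<lambda>a\<in>carrier A. \<ominus> x a) \<otimes>\<^bsub>?H\<^esub> x = \<one>\<^bsub>?H\<^esub>"
      using x by (auto simp: Hom_group_simps Hom_groupD M.l_neg intro!: restrict_ext)
  qed
qed

section \<open>Cocycles, coboundaries and the correction terms of terms\<close>

definition cobdry :: "('f, 'q) ualg \<Rightarrow> ('q \<Rightarrow> 'e) \<Rightarrow> 'f \<Rightarrow> 'q list \<Rightarrow> 'e" where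
  "cobdry Q h = (\<lambda>f. \<lambda>qs\<in>tuples (ar f) (carrier Q). kop E f (map h qs) \<ominus> h (oper Q f qs))"

lemma coboundaries_eq: "coboundaries ar Q E = cobdry Q ` (carrier Q \<rightarrow> carrier E)"
  by (auto simp: coboundaries_def cobdry_def)

lemma cocycles_closed: "S \<in> cocycles ar Q E \<Longrightarrow> qs \<in> tuples (ar f) (carrier Q) \<Longrightarrow> S f qs \<in> carrier E"
  by (auto simp: cocycles_def)

lemma cocyclesI:
  "(\<And>f qs. qs \<in> tuples (ar f) (carrier Q) \<Longrightarrow> S f qs \<in> carrier E) \<Longrightarrow>
   (\<lambda>f. \<lambda>qs\<in>tuples (ar f) (carrier Q). S f qs) \<in> cocycles ar Q E"
  by (auto simp: cocycles_def)

lemma cocycles_eqI: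
  assumes "S \<in> cocycles ar Q E" "T \<in> cocycles ar Q E"
    and "\<And>f qs. qs \<in> tuples (ar f) (carrier Q) \<Longrightarrow> S f qs = T f qs"
  shows "S = T"
proof
  fix f
  have "S f \<in> tuples (ar f) (carrier Q) \<rightarrow>\<^sub>E carrier E" "T f \<in> tuples (ar f) (carrier Q) \<rightarrow>\<^sub>E carrier E"
    using assms(1,2) by (auto simp: cocycles_def)
  then show "S f = T f" using assms(3) by (intro PiE_ext)
qed

lemma Z2_group_simps:
  "carrier (Z2_group ar Eqs Q E) = {T \<in> cocycles ar Q E. is_compatible ar Eqs Q E T}"
  "mult (Z2_group ar Eqs Q E) = (\<lambda>S T f. \<lambda>qs\<in>tuples (ar f) (carrier Q). S f qs \<oplus> T f qs)"
  "one (Z2_group ar Eqs Q E) = (\<lambda>f. \<lambda>qs\<in>tuples (ar f) (carrier Q). \<zero>)"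
  by (simp_all add: Z2_group_def)

text \<open>Closure of \<open>S\<close> is required only on tuples over \<open>Q\<close>, in place
  of membership in \<open>cocycles\<close>; this covers families that are not extensional, such as
  the constant zero family.\<close>

lemma dterm_closed:
  assumes Q: "is_algebra ar Q" and \<rho>: "\<And>x. \<rho> x \<in> carrier Q" and t: "t \<in> terms ar UNIV"
    and S: "\<And>f qs. qs \<in> tuples (ar f) (carrier Q) \<Longrightarrow> S f qs \<in> carrier E"
  shows "dterm E S Q \<rho> t \<in> carrier E"
  using t
proof induction
  case (terms_App ts f)
  then have "App f ts \<in> terms ar UNIV" by (auto intro: terms.terms_App)
  from eval_tuple[OF Q this \<rho>] terms_App show ?case
    by (auto intro!: M.add.m_closed kop_closed S simp: tuples_def)
qed auto

text \<open>Every step of the recursion is additive in the family because \<open>kop E f\<close> is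
  additive. The sum is a separate family \<open>U\<close> with a pointwise equation, so that the
  zero family can also be read as the sum of a cocycle and its negative.\<close>

lemma dterm_additive:
  fixes S T U :: "'f \<Rightarrow> 'q list \<Rightarrow> 'e"
  assumes Q: "is_algebra ar Q" and \<rho>: "\<And>x. \<rho> x \<in> carrier Q" and t: "t \<in> terms ar UNIV"
    and S: "\<And>f qs. qs \<in> tuples (ar f) (carrier Q) \<Longrightarrow> S f qs \<in> carrier E"
    and T: "\<And>f qs. qs \<in> tuples (ar f) (carrier Q) \<Longrightarrow> T f qs \<in> carrier E"
    and U: "\<And>f qs. qs \<in> tuples (ar f) (carrier Q) \<Longrightarrow> U f qs = S f qs \<oplus> T f qs"
  shows "dterm E U Q \<rho> t = dterm E S Q \<rho> t \<oplus> dterm E T Q \<rho> t"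
  using t
proof induction
  case (terms_App ts f)
  then have app: "App f ts \<in> terms ar UNIV" by (auto intro: terms.terms_App)
  have ts: "ts \<in> tuples (ar f) (terms ar UNIV)" using terms_App by (auto simp: tuples_def)
  note ev = eval_tuple[OF Q app \<rho>]
  have *: "map (dterm E U Q \<rho>) ts = map (\<lambda>t. dterm E S Q \<rho> t \<oplus> dterm E T Q \<rho> t) ts"
    using terms_App by auto
  have "kop E f (map (dterm E U Q \<rho>) ts) = kop E f (map (dterm E S Q \<rho>) ts) \<oplus> kop E f (map (dterm E T Q \<rho>) ts)"
    unfolding * by (rule kop_add[OF ts]) (auto intro!: dterm_closed[OF Q \<rho>] S T)
  moreover have "kop E f (map (dterm E S Q \<rho>) ts) \<in> carrier E" "kop E f (map (dterm E T Q \<rho>) ts) \<in> carrier E"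
    by (auto intro!: kop_map_closed[OF ts] dterm_closed[OF Q \<rho>] S T)
  ultimately show ?case
    using S[OF ev] T[OF ev] U[OF ev] by (simp add: M.a_ac)
qed auto

text \<open>The correction term telescopes along the term: the values of \<open>h\<close> at the
  subterms, subtracted by the induction hypothesis, are added back by the coboundary at the
  outermost symbol. Only the evaluation in \<open>E\<close> and one value of \<open>h\<close>
  survive.\<close>

lemma dterm_cobdry:
  assumes Q: "is_algebra ar Q" and \<rho>: "\<And>x. \<rho> x \<in> carrier Q" and t: "t \<in> terms ar UNIV"
    and h: "\<And>q. q \<in> carrier Q \<Longrightarrow> h q \<in> carrier E"
  shows "dterm E (cobdry Q h) Q \<rho> t = eval (alg E) (\<lambda>x. h (\<rho> x)) t \<ominus> h (eval Q \<rho> t)"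
  using t
proof induction
  case (terms_App ts f)
  then have app: "App f ts \<in> terms ar UNIV" by (auto intro: terms.terms_App)
  have ts: "ts \<in> tuples (ar f) (terms ar UNIV)" using terms_App by (auto simp: tuples_def)
  have algE: "is_algebra ar (alg E)"
    using kop_closed M.zero_closed by (fastforce simp: is_algebra_def alg_def)
  let ?e = "eval (alg E) (\<lambda>x. h (\<rho> x))" and ?q = "\<lambda>t. h (eval Q \<rho> t)"
  have ec: "?e t \<in> carrier E" if "t \<in> terms ar UNIV" for t
    using eval_in_carrier[OF algE that, of "\<lambda>x. h (\<rho> x)"] h \<rho> by (simp add: alg_def)
  have qc: "?q t \<in> carrier E" if "t \<in> terms ar UNIV" for t
    using eval_in_carrier[OF Q that] h \<rho> by blast
  note ev = eval_tuple[OF Q app \<rho>]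
  have *: "map (dterm E (cobdry Q h) Q \<rho>) ts = map (\<lambda>t. ?e t \<oplus> (\<ominus> ?q t)) ts"
    using terms_App by (auto simp: a_minus_def)
  have "kop E f (map (dterm E (cobdry Q h) Q \<rho>) ts) = kop E f (map ?e ts) \<oplus> kop E f (map (\<lambda>t. \<ominus> ?q t) ts)"
    unfolding * by (rule kop_add[OF ts]) (auto intro!: ec qc M.a_inv_closed)
  also have "kop E f (map (\<lambda>t. \<ominus> ?q t) ts) = \<ominus> kop E f (map ?q ts)"
    by (rule kop_uminus[OF ts qc])
  finally have 1: "kop E f (map (dterm E (cobdry Q h) Q \<rho>) ts) = kop E f (map ?e ts) \<ominus> kop E f (map ?q ts)"
    by (simp add: a_minus_def)
  have 2: "cobdry Q h f (map (eval Q \<rho>) ts) = kop E f (map ?q ts) \<ominus> h (eval Q \<rho> (App f ts))"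
    using ev by (simp add: cobdry_def comp_def)
  have c: "kop E f (map ?q ts) \<in> carrier E" "kop E f (map ?e ts) \<in> carrier E" "h (eval Q \<rho> (App f ts)) \<in> carrier E"
    using kop_map_closed[OF ts qc] kop_map_closed[OF ts ec] qc[OF app] by auto
  have 3: "?e (App f ts) = kop E f (map ?e ts)" by (simp add: alg_def)
  show ?case unfolding dterm.simps 1 2 3
    using c by (intro minus_add_minus)
qed (use h \<rho> in \<open>simp add: M.r_neg a_minus_def\<close>)

lemma compatibleD:
  assumes "is_compatible ar Eqs Q E S" "(s, t) \<in> identities ar Eqs (UNIV :: nat set)" "\<And>x. \<rho> x \<in> carrier Q"
  shows "dterm E S Q \<rho> s = dterm E S Q \<rho> t"
  using assms by (auto simp: is_compatible_def)

lemma compatible_additive: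
  assumes Q: "is_algebra ar Q" "is_compatible ar Eqs Q E S" "is_compatible ar Eqs Q E T"
    and S: "\<And>f qs. qs \<in> tuples (ar f) (carrier Q) \<Longrightarrow> S f qs \<in> carrier E"
    and T: "\<And>f qs. qs \<in> tuples (ar f) (carrier Q) \<Longrightarrow> T f qs \<in> carrier E"
    and U: "\<And>f qs. qs \<in> tuples (ar f) (carrier Q) \<Longrightarrow> U f qs = S f qs \<oplus> T f qs"
  shows "is_compatible ar Eqs Q E U"
  unfolding is_compatible_def
proof clarify
  fix s t :: "('f, nat) trm" and \<rho> :: "nat \<Rightarrow> _"
  assume st: "(s, t) \<in> identities ar Eqs (UNIV :: nat set)" and \<rho>: "\<forall>x. \<rho> x \<in> carrier Q"
  then have "dterm E S Q \<rho> s = dterm E S Q \<rho> t" "dterm E T Q \<rho> s = dterm E T Q \<rho> t"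
    using Q(2,3) by (auto simp: is_compatible_def)
  moreover have "s \<in> terms ar UNIV" "t \<in> terms ar UNIV" using st by (auto simp: identities_def)
  ultimately show "dterm E U Q \<rho> s = dterm E U Q \<rho> t"
    using dterm_additive[of Q \<rho> _ S T U] Q(1) S T U \<rho> by metis
qed

text \<open>By \<open>dterm_cobdry\<close> the correction term depends on the term only through its
  values in \<open>E\<close> and in \<open>Q\<close>, and both algebras satisfy the identities of
  the variety.\<close>

lemma compatible_cobdry:
  assumes Eqs: "is_identity_set ar Eqs" and Q: "in_variety ar Eqs Q" and E: "in_variety ar Eqs (alg E)"
    and h: "\<And>q. q \<in> carrier Q \<Longrightarrow> h q \<in> carrier E"
  shows "is_compatible ar Eqs Q E (cobdry Q h)"
  unfolding is_compatible_def
proof clarify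
  fix s t :: "('f, nat) trm" and \<rho> :: "nat \<Rightarrow> _"
  assume st: "(s, t) \<in> identities ar Eqs (UNIV :: nat set)" and \<rho>: "\<forall>x. \<rho> x \<in> carrier Q"
  have "s \<in> terms ar UNIV" "t \<in> terms ar UNIV" using st by (auto simp: identities_def)
  moreover have *: "dterm E (cobdry Q h) Q \<rho> u = eval (alg E) (\<lambda>x. h (\<rho> x)) u \<ominus> h (eval Q \<rho> u)"
    if "u \<in> terms ar UNIV" for u
    by (rule dterm_cobdry[OF in_variety_algebra[OF Q] _ that]) (use \<rho> h in auto)
  moreover have "eval Q \<rho> s = eval Q \<rho> t"
    using identities_hold[OF Eqs Q st] \<rho> by (auto simp: satisfies_def)
  moreover have "eval (alg E) (\<lambda>x. h (\<rho> x)) s = eval (alg E) (\<lambda>x. h (\<rho> x)) t"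
    using identities_hold[OF Eqs E st] \<rho> h by (auto simp: satisfies_def alg_def)
  ultimately show "dterm E (cobdry Q h) Q \<rho> s = dterm E (cobdry Q h) Q \<rho> t"
    by (simp only: *)
qed

lemma cobdry_in_cocycles:
  assumes "is_algebra ar Q" "\<And>q. q \<in> carrier Q \<Longrightarrow> h q \<in> carrier E"
  shows "cobdry Q h \<in> cocycles ar Q E"
  unfolding cobdry_def
  using assms by (intro cocyclesI M.minus_closed kop_map_closed) (auto simp: oper_closed)

lemma cobdry_add:
  assumes Q: "is_algebra ar Q" and h: "\<And>q. q \<in> carrier Q \<Longrightarrow> h q \<in> carrier E"
    and k: "\<And>q. q \<in> carrier Q \<Longrightarrow> k q \<in> carrier E"
    and qs: "qs \<in> tuples (ar f) (carrier Q)"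
  shows "cobdry Q (\<lambda>q. h q \<oplus> k q) f qs = cobdry Q h f qs \<oplus> cobdry Q k f qs"
  using assms
  by (simp add: cobdry_def kop_add[where X = "carrier Q"] oper_closed kop_map_closed[where X = "carrier Q"] minus_add_add)

end

section \<open>The group of compatible cocycles and the subgroup of coboundaries\<close>

locale kernel_variety = kernel_algebra ar m R E
  for ar :: "'f \<Rightarrow> nat" and m :: 'f and R :: "'r ring" and E :: "('r, 'e, 'f) kernel_alg" (structure) +
  fixes Eqs :: "(('f, nat) trm \<times> ('f, nat) trm) set"
  assumes Eqs: "is_identity_set ar Eqs" and dt: "difference_term ar Eqs m"
    and E_variety: "in_variety ar Eqs (alg E)"
begin

lemma comm_group_Z2:
  assumes QV: "in_variety ar Eqs Q"
  shows "comm_group (Z2_group ar Eqs Q E)"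
proof (rule comm_groupI)
  let ?Z = "Z2_group ar Eqs Q E"
  note Q = in_variety_algebra[OF QV]
  show mc: "x \<otimes>\<^bsub>?Z\<^esub> y \<in> carrier ?Z" if "x \<in> carrier ?Z" "y \<in> carrier ?Z" for x y
    using that by (auto simp: Z2_group_simps cocycles_closed intro!: cocyclesI compatible_additive[of Q Eqs x y] Q)
  show oc: "\<one>\<^bsub>?Z\<^esub> \<in> carrier ?Z"
  proof -
    \<comment> \<open>Writing the neutral element as the coboundary of the zero function yields its
      compatibility from \<open>compatible_cobdry\<close>.\<close>
    have "cobdry Q (\<lambda>_. \<zero>) = \<one>\<^bsub>?Z\<^esub>"
      unfolding cobdry_def Z2_group_simps by (auto intro!: restrict_ext ext simp: kop_zero a_minus_def)
    then show ?thesis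
      using compatible_cobdry[OF Eqs QV E_variety, of "\<lambda>_. \<zero>"] cobdry_in_cocycles[OF Q, of "\<lambda>_. \<zero>"]
      by (simp add: Z2_group_simps)
  qed
  show "x \<otimes>\<^bsub>?Z\<^esub> y \<otimes>\<^bsub>?Z\<^esub> z = x \<otimes>\<^bsub>?Z\<^esub> (y \<otimes>\<^bsub>?Z\<^esub> z)"
    if "x \<in> carrier ?Z" "y \<in> carrier ?Z" "z \<in> carrier ?Z" for x y z
    using that by (auto simp: Z2_group_simps cocycles_closed M.a_ac intro!: restrict_ext)
  show "x \<otimes>\<^bsub>?Z\<^esub> y = y \<otimes>\<^bsub>?Z\<^esub> x" if "x \<in> carrier ?Z" "y \<in> carrier ?Z" for x y
    using that by (auto simp: Z2_group_simps cocycles_closed M.a_ac intro!: restrict_ext)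
  show "\<one>\<^bsub>?Z\<^esub> \<otimes>\<^bsub>?Z\<^esub> x = x" if "x \<in> carrier ?Z" for x
    by (rule cocycles_eqI[of _ Q])
       (use that mc[OF oc that] in \<open>auto simp: Z2_group_simps cocycles_closed\<close>)
  show "\<exists>y\<in>carrier ?Z. y \<otimes>\<^bsub>?Z\<^esub> x = \<one>\<^bsub>?Z\<^esub>" if x: "x \<in> carrier ?Z" for x
  proof
    let ?y = "\<lambda>f. \<lambda>qs\<in>tuples (ar f) (carrier Q). \<ominus> x f qs"
    have xc: "x f qs \<in> carrier E" if "qs \<in> tuples (ar f) (carrier Q)" for f qs
      using x that by (auto simp: Z2_group_simps cocycles_closed)
    \<comment> \<open>Correction terms are additive and vanish for the zero family, so those of the
      pointwise negative are the negatives; equality on both sides of an identity is then inherited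
      from \<open>x\<close>.\<close>
    have "dterm E ?y Q \<rho> t = \<ominus> dterm E x Q \<rho> t"
      if \<rho>: "\<forall>v. \<rho> v \<in> carrier Q" and t: "t \<in> terms ar UNIV" for \<rho> :: "nat \<Rightarrow> _" and t
    proof -
      have z: "dterm E (\<lambda>_ _. \<zero>) Q \<rho> t = \<zero>"
      proof -
        have "dterm E (\<lambda>_ _. \<zero>) Q \<rho> t = dterm E (\<lambda>_ _. \<zero>) Q \<rho> t \<oplus> dterm E (\<lambda>_ _. \<zero>) Q \<rho> t"
          by (rule dterm_additive[OF Q _ t]) (use \<rho> in auto)
        moreover have "dterm E (\<lambda>_ _. \<zero>) Q \<rho> t \<in> carrier E"
          by (rule dterm_closed[OF Q _ t]) (use \<rho> in auto)
        ultimately show ?thesis by (metis M.add.r_cancel_one)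
      qed
      have "dterm E (\<lambda>_ _. \<zero>) Q \<rho> t = dterm E ?y Q \<rho> t \<oplus> dterm E x Q \<rho> t"
        by (rule dterm_additive[OF Q _ t]) (use \<rho> xc in \<open>auto simp: M.l_neg\<close>)
      then show ?thesis
        unfolding z using \<rho> xc
        by (intro M.minus_equality[symmetric]) (auto intro!: dterm_closed[OF Q _ t])
    qed
    then have "is_compatible ar Eqs Q E ?y"
      using x by (fastforce simp: Z2_group_simps is_compatible_def identities_def)
    then show "?y \<in> carrier ?Z"
      using xc by (auto simp: Z2_group_simps intro!: cocyclesI)
    show "?y \<otimes>\<^bsub>?Z\<^esub> x = \<one>\<^bsub>?Z\<^esub>"
      using xc by (auto simp: Z2_group_simps M.l_neg intro!: restrict_ext)
  qed
qed

text \<open>Passing from \<open>h\<close> to its coboundary is additive, so closure of functions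
  under sums and negatives carries over to coboundaries.\<close>

lemma subgroup_coboundaries:
  assumes QV: "in_variety ar Eqs Q"
  shows "subgroup (coboundaries ar Q E) (Z2_group ar Eqs Q E)"
proof -
  let ?Z = "Z2_group ar Eqs Q E"
  interpret Z: comm_group ?Z by (rule comm_group_Z2[OF QV])
  note Q = in_variety_algebra[OF QV]
  have in_Z: "cobdry Q h \<in> carrier ?Z" if "h \<in> carrier Q \<rightarrow> carrier E" for h
    using compatible_cobdry[OF Eqs QV E_variety, of h] cobdry_in_cocycles[OF Q, of h] that
    by (auto simp: Z2_group_simps)
  have add: "cobdry Q h \<otimes>\<^bsub>?Z\<^esub> cobdry Q k = cobdry Q (\<lambda>q. h q \<oplus> k q)"
    if "h \<in> carrier Q \<rightarrow> carrier E" "k \<in> carrier Q \<rightarrow> carrier E" for h k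
  proof (rule cocycles_eqI[of _ Q])
    show "cobdry Q h \<otimes>\<^bsub>?Z\<^esub> cobdry Q k \<in> cocycles ar Q E"
      using Z.m_closed[OF in_Z in_Z] that by (auto simp: Z2_group_simps)
    show "cobdry Q (\<lambda>q. h q \<oplus> k q) \<in> cocycles ar Q E"
      using that by (intro cobdry_in_cocycles[OF Q]) auto
  qed (use that in \<open>simp add: cobdry_add[OF Q] Z2_group_simps Pi_iff\<close>)
  have zero: "cobdry Q (\<lambda>_. \<zero>) = \<one>\<^bsub>?Z\<^esub>"
    unfolding cobdry_def Z2_group_simps by (auto intro!: restrict_ext ext simp: kop_zero a_minus_def)
  show ?thesis
  proof (rule Z.subgroupI)
    show "coboundaries ar Q E \<subseteq> carrier ?Z" using in_Z by (auto simp: coboundaries_eq)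
    show "coboundaries ar Q E \<noteq> {}" by (auto simp: coboundaries_eq)
    show "a \<otimes>\<^bsub>?Z\<^esub> b \<in> coboundaries ar Q E"
      if "a \<in> coboundaries ar Q E" "b \<in> coboundaries ar Q E" for a b
      using that by (auto simp: coboundaries_eq add intro!: imageI M.add.m_closed intro: funcset_mem)
    show "inv\<^bsub>?Z\<^esub> a \<in> coboundaries ar Q E" if a: "a \<in> coboundaries ar Q E" for a
    proof -
      from a obtain h where h: "h \<in> carrier Q \<rightarrow> carrier E" "a = cobdry Q h"
        by (auto simp: coboundaries_eq)
      then have h': "(\<lambda>q. \<ominus> h q) \<in> carrier Q \<rightarrow> carrier E" by auto
      have "cobdry Q (\<lambda>q. \<ominus> h q) \<otimes>\<^bsub>?Z\<^esub> a = cobdry Q (\<lambda>q. \<ominus> h q \<oplus> h q)"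
        using add[OF h' h(1)] h(2) by simp
      also have "\<dots> = cobdry Q (\<lambda>q. \<zero>)"
      proof -
        \<comment> \<open>Off the carrier \<open>h\<close> is arbitrary, so the two functions are
          known to agree only on \<open>Q\<close>; this suffices because \<open>cobdry\<close> is
          restricted to tuples over \<open>Q\<close>.\<close>
        have "map (\<lambda>q. \<ominus> h q \<oplus> h q) qs = map (\<lambda>q. \<zero>) qs" if "qs \<in> tuples (ar f) (carrier Q)" for f qs
          using that h by (auto simp: tuples_def M.l_neg Pi_iff subset_iff)
        then show ?thesis
          using h oper_closed[OF Q] unfolding cobdry_def by (intro ext restrict_ext) (auto simp: M.l_neg Pi_iff simp del: map_eq_conv)
      qed
      finally have "inv\<^bsub>?Z\<^esub> a = cobdry Q (\<lambda>q. \<ominus> h q)"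
        using in_Z h h' zero by (intro Z.inv_equality) auto
      then show ?thesis using h' by (auto simp: coboundaries_eq)
    qed
  qed
qed

text \<open>Compatibility is applied to the identity m(x,x,y) = y. The left side has correction term
  \<open>kop E m\<close> at zeros plus \<open>S m [q, q, q']\<close>, and the variable on the right
  has correction term zero.\<close>

lemma compatible_m_zero:
  assumes QV: "in_variety ar Eqs Q" and S: "S \<in> cocycles ar Q E" "is_compatible ar Eqs Q E S"
    and q: "q \<in> carrier Q" "q' \<in> carrier Q"
  shows "S m [q, q, q'] = \<zero>"
proof -
  let ?s = "App m [Var 0, Var 0, Var (1::nat)]" and ?t = "Var (1::nat)"
  let ?\<rho> = "\<lambda>i::nat. if i = 0 then q else q'"
  have m3: "ar m = 3" using dt by (simp add: difference_term_def)
  have "?s \<in> terms ar UNIV" "?t \<in> terms ar UNIV"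
    using m3 by (auto intro!: terms.intros)
  \<comment> \<open>\<open>identities\<close> and \<open>difference_term\<close> quantify over the
    same small algebras, so the identity is read off directly.\<close>
  moreover have "satisfies A ?s ?t" if "in_variety ar Eqs A" for A :: "'f small_alg"
    using dt that by (auto simp: satisfies_def difference_term_def)
  ultimately have "(?s, ?t) \<in> identities ar Eqs UNIV"
    by (auto simp: identities_def)
  then have "dterm E S Q ?\<rho> ?s = dterm E S Q ?\<rho> ?t"
    by (rule compatibleD[OF S(2)]) (use q in auto)
  moreover have "[q, q, q'] \<in> tuples (ar m) (carrier Q)" using q m3 by (auto simp: tuples_def)
  then have "S m [q, q, q'] \<in> carrier E" using S(1) by (rule cocycles_closed[rotated])
  ultimately show ?thesis by (simp add: kop_m a_minus_def M.r_neg)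
qed

end

text \<open>Two representatives of a coset of \<open>N\<close> differ by an element that
  \<open>g\<close> sends into \<open>M\<close>, so all cosets in the union coincide. This is the
  well-definedness of \<open>infl_H2\<close>, which is written as a union over
  representatives.\<close>

lemma induced_coset_map:
  assumes G: "group G" "N \<lhd> G" and H: "group H" "M \<lhd> H"
    and g: "g \<in> hom G H" and N: "\<And>x. x \<in> N \<Longrightarrow> g x \<in> M" and x: "x \<in> carrier G"
  shows "(\<Union>y \<in> N #>\<^bsub>G\<^esub> x. M #>\<^bsub>H\<^esub> g y) = M #>\<^bsub>H\<^esub> g x"
proof -
  interpret G: group G by fact
  interpret H: group H by fact
  have sN: "subgroup N G" and sM: "subgroup M H" using G H by (auto simp: normal_def)
  have "M #>\<^bsub>H\<^esub> g y = M #>\<^bsub>H\<^esub> g x" if "y \<in> N #>\<^bsub>G\<^esub> x" for y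
  proof -
    from that obtain n where n: "n \<in> N" "y = n \<otimes>\<^bsub>G\<^esub> x" by (auto simp: r_coset_def)
    have nG: "n \<in> carrier G" using n sN by (auto dest: subgroup.mem_carrier)
    have "g y = g n \<otimes>\<^bsub>H\<^esub> g x" using g n nG x by (simp add: hom_mult)
    then have "g y \<in> M #>\<^bsub>H\<^esub> g x" using N[OF n(1)] by (auto simp: r_coset_def)
    then show ?thesis using H.repr_independence[OF _ _ sM] hom_in_carrier[OF g x] by metis
  qed
  moreover have "N #>\<^bsub>G\<^esub> x \<noteq> {}" using G.rcos_self[OF x sN] by auto
  ultimately show ?thesis by auto
qed

text \<open>Cosets multiply through representatives, and \<open>induced_coset_map\<close> evaluates
  each union at any chosen representative; the claim thus reduces to multiplicativity of
  \<open>g\<close>.\<close>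

lemma induced_coset_hom:
  assumes G: "group G" "N \<lhd> G" and H: "group H" "M \<lhd> H"
    and g: "g \<in> hom G H" and N: "\<And>x. x \<in> N \<Longrightarrow> g x \<in> M"
  shows "(\<lambda>C. \<Union>y \<in> C. M #>\<^bsub>H\<^esub> g y) \<in> hom (G Mod N) (H Mod M)"
proof (rule homI)
  interpret G: group G by fact
  note ind = induced_coset_map[OF assms]
  show "(\<Union>y \<in> C. M #>\<^bsub>H\<^esub> g y) \<in> carrier (H Mod M)" if "C \<in> carrier (G Mod N)" for C
    using that ind hom_in_carrier[OF g] by (auto simp: carrier_FactGroup)
  show "(\<Union>y \<in> C \<otimes>\<^bsub>G Mod N\<^esub> D. M #>\<^bsub>H\<^esub> g y) =
      (\<Union>y \<in> C. M #>\<^bsub>H\<^esub> g y) \<otimes>\<^bsub>H Mod M\<^esub> (\<Union>y \<in> D. M #>\<^bsub>H\<^esub> g y)"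
    if CD: "C \<in> carrier (G Mod N)" "D \<in> carrier (G Mod N)" for C D
  proof -
    obtain x y where xy: "x \<in> carrier G" "y \<in> carrier G" and "C = N #>\<^bsub>G\<^esub> x" "D = N #>\<^bsub>G\<^esub> y"
      using CD by (auto simp: carrier_FactGroup)
    then show ?thesis
      using hom_in_carrier[OF g] G.m_closed[OF xy] hom_mult[OF g xy]
      by (simp add: normal.rcos_sum[OF G(2)] normal.rcos_sum[OF H(2)] ind)
  qed
qed

section \<open>Cohomology classes\<close>

context kernel_variety
begin

lemma normal_coboundaries:
  "in_variety ar Eqs Q \<Longrightarrow> coboundaries ar Q E \<lhd> Z2_group ar Eqs Q E"
  by (intro comm_group.subgroup_imp_normal comm_group_Z2 subgroup_coboundaries)

lemma comm_group_H2: "in_variety ar Eqs Q \<Longrightarrow> comm_group (H2_group ar Eqs Q E)"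
  unfolding H2_group_def by (intro comm_group.abelian_FactGroup comm_group_Z2 subgroup_coboundaries)

lemma H2_class_hom:
  "in_variety ar Eqs Q \<Longrightarrow> H2_class ar Eqs Q E \<in> hom (Z2_group ar Eqs Q E) (H2_group ar Eqs Q E)"
  using normal.r_coset_hom_Mod[OF normal_coboundaries]
  unfolding H2_group_def H2_class_def[abs_def] .

lemma H2_carrier: "carrier (H2_group ar Eqs Q E) = H2_class ar Eqs Q E ` carrier (Z2_group ar Eqs Q E)"
  by (simp add: H2_group_def H2_class_def[abs_def] carrier_FactGroup)

lemma H2_class_eq_one_iff:
  assumes "in_variety ar Eqs Q" "S \<in> carrier (Z2_group ar Eqs Q E)"
  shows "H2_class ar Eqs Q E S = \<one>\<^bsub>H2_group ar Eqs Q E\<^esub> \<longleftrightarrow> S \<in> coboundaries ar Q E"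
proof -
  interpret Z: comm_group "Z2_group ar Eqs Q E" by (rule comm_group_Z2[OF assms(1)])
  show ?thesis
    using Z.coset_join1[OF _ assms(2) subgroup_coboundaries[OF assms(1)]]
      Z.coset_join2[OF assms(2) subgroup_coboundaries[OF assms(1)]]
    by (auto simp: H2_group_def H2_class_def)
qed

end

section \<open>The splitting of cobounding functions\<close>

locale realized_extension =
  B: kernel_variety ar m R B Eqs + E: kernel_variety ar m R' E Eqs
  for ar :: "'f \<Rightarrow> nat" and m :: 'f and R :: "'r ring" and B :: "('r, 'b, 'f) kernel_alg"
    and R' :: "'s ring" and E :: "('s, 'e, 'f) kernel_alg"
    and Eqs :: "(('f, nat) trm \<times> ('f, nat) trm) set" +
  fixes A :: "('f, 'a) ualg" and Q :: "('f, 'q) ualg" and \<pi> :: "'a \<Rightarrow> 'q"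
    and T :: "'f \<Rightarrow> 'q list \<Rightarrow> 'b" and \<psi> :: "'a \<Rightarrow> 'b \<times> 'q"
  assumes A_variety: "in_variety ar Eqs A" and Q_variety: "in_variety ar Eqs Q"
    and realizes: "realizes_via ar Eqs A Q \<pi> B T \<psi>"
begin

section \<open>Coordinates on the extension\<close>

abbreviation \<beta> :: "'a \<Rightarrow> 'b" where "\<beta> a \<equiv> fst (\<psi> a)"

text \<open>The element of \<open>A\<close> with coordinates \<open>(b, q)\<close>. It is spelled
  exactly as the inverse of \<open>\<psi>\<close> occurs in \<open>restr\<close>, so that
  \<open>restr\<close> can be folded into values at such points.\<close>

definition pt :: "'b \<Rightarrow> 'q \<Rightarrow> 'a" where "pt b q = inv_into (carrier A) \<psi> (b, q)"

abbreviation r where "r \<equiv> restr A Q \<psi> B E"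

lemmas A_alg = in_variety_algebra[OF A_variety] and Q_alg = in_variety_algebra[OF Q_variety]

lemma ar_m: "ar m = 3"
  using B.dt by (simp add: difference_term_def)

lemma T_closed: "qs \<in> tuples (ar f) (carrier Q) \<Longrightarrow> T f qs \<in> carrier B"
  using realizes B.cocycles_closed by (auto simp: realizes_via_def)

lemma \<psi>_bij: "bij_betw \<psi> (carrier A) (carrier B \<times> carrier Q)"
  using realizes by (simp add: realizes_via_def alg_iso_def twisted_alg_def)

lemma snd_\<psi>: "a \<in> carrier A \<Longrightarrow> snd (\<psi> a) = \<pi> a"
  using realizes by (simp add: realizes_via_def)

lemma \<beta>_closed: "a \<in> carrier A \<Longrightarrow> \<beta> a \<in> carrier B"
  using bij_betwE[OF \<psi>_bij] by (auto simp: mem_Times_iff)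

lemma \<pi>_closed: "a \<in> carrier A \<Longrightarrow> \<pi> a \<in> carrier Q"
  using bij_betwE[OF \<psi>_bij] snd_\<psi> by (auto simp: mem_Times_iff)

lemma \<psi>_oper:
  assumes xs: "xs \<in> tuples (ar f) (carrier A)"
  shows "\<beta> (oper A f xs) = kop B f (map \<beta> xs) \<oplus>\<^bsub>B\<^esub> T f (map \<pi> xs)"
    and "\<pi> (oper A f xs) = oper Q f (map \<pi> xs)"
proof -
  have "map snd (map \<psi> xs) = map \<pi> xs" using xs snd_\<psi> by (auto simp: tuples_def)
  moreover have "map fst (map \<psi> xs) = map \<beta> xs" by simp
  moreover have "\<psi> (oper A f xs) = oper (twisted_alg B T Q) f (map \<psi> xs)"
    using realizes xs by (auto simp: realizes_via_def alg_iso_def alg_hom_def)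
  ultimately have "\<psi> (oper A f xs) = (kop B f (map \<beta> xs) \<oplus>\<^bsub>B\<^esub> T f (map \<pi> xs), oper Q f (map \<pi> xs))"
    by (simp add: twisted_alg_def del: map_map)
  then show "\<beta> (oper A f xs) = kop B f (map \<beta> xs) \<oplus>\<^bsub>B\<^esub> T f (map \<pi> xs)"
    and "\<pi> (oper A f xs) = oper Q f (map \<pi> xs)"
    using snd_\<psi>[OF oper_closed[OF A_alg xs]] by auto
qed

lemma pt:
  assumes "b \<in> carrier B" "q \<in> carrier Q"
  shows "pt b q \<in> carrier A" "\<beta> (pt b q) = b" "\<pi> (pt b q) = q"
proof -
  have *: "(b, q) \<in> \<psi> ` carrier A" using \<psi>_bij assms by (auto simp: bij_betw_def)
  then show c: "pt b q \<in> carrier A" unfolding pt_def by (rule inv_into_into)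
  have "\<psi> (pt b q) = (b, q)" unfolding pt_def using * by (rule f_inv_into_f)
  then show "\<beta> (pt b q) = b" "\<pi> (pt b q) = q" using snd_\<psi>[OF c] by auto
qed

lemma pt_eq: "a \<in> carrier A \<Longrightarrow> pt (\<beta> a) (\<pi> a) = a"
  using \<psi>_bij snd_\<psi>[of a] unfolding pt_def by (metis bij_betw_def inv_into_f_f prod.collapse)

lemma ptI: "a \<in> carrier A \<Longrightarrow> \<beta> a = b \<Longrightarrow> \<pi> a = q \<Longrightarrow> a = pt b q"
  using pt_eq by metis

text \<open>For \<open>a\<close> and \<open>a'\<close> in one fibre the cocycle value is
  T_m(q,q,q'), which vanishes, and the second coordinate is m(q,q,q') = q'. Hence \<open>m\<close>
  translates \<open>a''\<close> inside its own fibre by the difference of \<open>a\<close> and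
  \<open>a'\<close>.\<close>

lemma m_fibre:
  assumes a: "a \<in> carrier A" "a' \<in> carrier A" "a'' \<in> carrier A" and eq: "\<pi> a = \<pi> a'"
  shows "oper A m [a, a', a''] = pt (\<beta> a \<ominus>\<^bsub>B\<^esub> \<beta> a' \<oplus>\<^bsub>B\<^esub> \<beta> a'') (\<pi> a'')"
proof (rule ptI)
  have xs: "[a, a', a''] \<in> tuples (ar m) (carrier A)" using a ar_m by (auto simp: tuples_def)
  show "oper A m [a, a', a''] \<in> carrier A" by (rule oper_closed[OF A_alg xs])
  have "T m [\<pi> a', \<pi> a', \<pi> a''] = \<zero>\<^bsub>B\<^esub>"
    using realizes a by (intro B.compatible_m_zero[OF Q_variety]) (auto simp: realizes_via_def \<pi>_closed)
  then show "\<beta> (oper A m [a, a', a'']) = \<beta> a \<ominus>\<^bsub>B\<^esub> \<beta> a' \<oplus>\<^bsub>B\<^esub> \<beta> a''"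
    using a eq by (simp add: \<psi>_oper(1)[OF xs] B.kop_m \<beta>_closed)
  show "\<pi> (oper A m [a, a', a'']) = \<pi> a''"
    using a eq difference_term_transfer(1)[OF B.Eqs Q_variety B.dt] by (simp add: \<psi>_oper(2)[OF xs] \<pi>_closed)
qed

text \<open>Compatibility with translations along fibres. It is the one property behind the
  splitting of \<open>h\<close>, and it is shared by homomorphisms into \<open>E\<close> and by
  functions whose coboundary is pulled back from a compatible cocycle on \<open>Q\<close>.\<close>

definition fibrewise_affine :: "('a \<Rightarrow> 'e) \<Rightarrow> bool" where
  "fibrewise_affine h \<longleftrightarrow> h \<in> carrier A \<rightarrow> carrier E \<and>
     (\<forall>a\<in>carrier A. \<forall>a'\<in>carrier A. \<forall>a''\<in>carrier A. \<pi> a = \<pi> a' \<longrightarrow>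
        h (oper A m [a, a', a'']) = h a \<ominus>\<^bsub>E\<^esub> h a' \<oplus>\<^bsub>E\<^esub> h a'')"

lemma fibrewise_affineD:
  assumes "fibrewise_affine h" "a \<in> carrier A" "a' \<in> carrier A" "a'' \<in> carrier A" "\<pi> a = \<pi> a'"
  shows "h (oper A m [a, a', a'']) = h a \<ominus>\<^bsub>E\<^esub> h a' \<oplus>\<^bsub>E\<^esub> h a''"
  using assms by (simp add: fibrewise_affine_def)

context
  fixes h assumes h: "fibrewise_affine h"
begin

lemma h_closed: "a \<in> carrier A \<Longrightarrow> h a \<in> carrier E"
  using h by (auto simp: fibrewise_affine_def)

text \<open>By \<open>m_fibre\<close>, m((b,q),(0,q),(b',q')) = (b + b',q'). The fibres of
  \<open>q\<close> and \<open>q'\<close> may differ, so one equation yields both independence of the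
  fibre and additivity.\<close>

lemma affine_pt:
  assumes b: "b \<in> carrier B" "b' \<in> carrier B" and q: "q \<in> carrier Q" "q' \<in> carrier Q"
  shows "h (pt (b \<oplus>\<^bsub>B\<^esub> b') q') = h (pt b q) \<ominus>\<^bsub>E\<^esub> h (pt \<zero>\<^bsub>B\<^esub> q) \<oplus>\<^bsub>E\<^esub> h (pt b' q')"
proof -
  have "oper A m [pt b q, pt \<zero>\<^bsub>B\<^esub> q, pt b' q'] = pt (b \<oplus>\<^bsub>B\<^esub> b') q'"
    using b q by (subst m_fibre) (auto simp: pt B.uminus_zero a_minus_def)
  then show ?thesis
    using fibrewise_affineD[OF h, of "pt b q" "pt \<zero>\<^bsub>B\<^esub> q" "pt b' q'"] b q by (simp add: pt)
qed

text \<open>The case \<open>b' = 0\<close> of \<open>affine_pt\<close> makes the difference the same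
  over every fibre, so the definite description in \<open>restr\<close> has a value and any single
  \<open>q\<close> computes it.\<close>

lemma restr_eq:
  assumes b: "b \<in> carrier B" and q: "q \<in> carrier Q"
  shows "r h b = h (pt b q) \<ominus>\<^bsub>E\<^esub> h (pt \<zero>\<^bsub>B\<^esub> q)"
proof -
  have "h (pt b q') \<ominus>\<^bsub>E\<^esub> h (pt \<zero>\<^bsub>B\<^esub> q') = h (pt b q) \<ominus>\<^bsub>E\<^esub> h (pt \<zero>\<^bsub>B\<^esub> q)"
    if q': "q' \<in> carrier Q" for q'
    using affine_pt[OF b _ q q', of "\<zero>\<^bsub>B\<^esub>"] b q q' h_closed pt
    by (simp add: a_minus_def E.M.a_assoc E.M.r_neg)
  then have *: "\<forall>q'\<in>carrier Q. h (pt b q) \<ominus>\<^bsub>E\<^esub> h (pt \<zero>\<^bsub>B\<^esub> q) = h (pt b q') \<ominus>\<^bsub>E\<^esub> h (pt \<zero>\<^bsub>B\<^esub> q')"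
    by metis
  have "(THE e. \<forall>q\<in>carrier Q. e = h (pt b q) \<ominus>\<^bsub>E\<^esub> h (pt \<zero>\<^bsub>B\<^esub> q)) =
      h (pt b q) \<ominus>\<^bsub>E\<^esub> h (pt \<zero>\<^bsub>B\<^esub> q)"
  proof (rule the_equality)
    show "e = h (pt b q) \<ominus>\<^bsub>E\<^esub> h (pt \<zero>\<^bsub>B\<^esub> q)"
      if "\<forall>q\<in>carrier Q. e = h (pt b q) \<ominus>\<^bsub>E\<^esub> h (pt \<zero>\<^bsub>B\<^esub> q)" for e
      by (rule bspec[OF that q])
  qed (rule *)
  then show ?thesis
    unfolding restr_def pt_def[symmetric] using b by (simp only: restrict_apply')
qed

lemma restr_closed: "b \<in> carrier B \<Longrightarrow> r h b \<in> carrier E"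
proof -
  assume b: "b \<in> carrier B"
  obtain q where "q \<in> carrier Q" using Q_alg by (auto simp: is_algebra_def)
  then show ?thesis using b by (subst restr_eq) (auto simp: h_closed pt)
qed

lemma restr_add:
  assumes b: "b \<in> carrier B" "b' \<in> carrier B"
  shows "r h (b \<oplus>\<^bsub>B\<^esub> b') = r h b \<oplus>\<^bsub>E\<^esub> r h b'"
proof -
  obtain q where q: "q \<in> carrier Q" using Q_alg by (auto simp: is_algebra_def)
  show ?thesis
    using b q affine_pt[OF b q q] h_closed pt
    by (simp add: restr_eq[OF _ q] a_minus_def E.M.a_assoc)
qed

lemma restr_zero: "r h \<zero>\<^bsub>B\<^esub> = \<zero>\<^bsub>E\<^esub>"
  using restr_add[of "\<zero>\<^bsub>B\<^esub>" "\<zero>\<^bsub>B\<^esub>"] restr_closed[of "\<zero>\<^bsub>B\<^esub>"]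
  by (simp add: E.M.add.r_cancel_one)

text \<open>Compute \<open>restr\<close> in the fibre of \<open>a\<close> itself. The summands
  depend on the first and on the second coordinate alone; the base points \<open>pt\<close> with
  first coordinate zero serve as a section of \<open>\<pi>\<close>.\<close>

lemma restr_split:
  assumes "a \<in> carrier A"
  shows "h a = r h (\<beta> a) \<oplus>\<^bsub>E\<^esub> h (pt \<zero>\<^bsub>B\<^esub> (\<pi> a))"
  using assms restr_eq[of "\<beta> a" "\<pi> a"] \<beta>_closed[OF assms] \<pi>_closed[OF assms] h_closed pt pt_eq[OF assms]
  by (simp add: a_minus_def E.M.a_assoc E.M.l_neg)

end

text \<open>The last hypothesis says that the pullback of \<open>S\<close> to \<open>A\<close> is
  the coboundary of \<open>h\<close>. At \<open>m\<close> on a fibre this coboundary vanishes, so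
  \<open>h\<close> is fibrewise affine and splits; evaluating the coboundary of the splitting at
  suitable lifts separates the two parts. \<open>S\<close> is only a family of values, so that the
  zero family is an instance.\<close>

lemma
  assumes S: "\<And>f qs. qs \<in> tuples (ar f) (carrier Q) \<Longrightarrow> S f qs \<in> carrier E"
    and Sm: "\<And>q q'. q \<in> carrier Q \<Longrightarrow> q' \<in> carrier Q \<Longrightarrow> S m [q, q, q'] = \<zero>\<^bsub>E\<^esub>"
    and hc: "h \<in> carrier A \<rightarrow> carrier E"
    and hS: "\<And>f xs. xs \<in> tuples (ar f) (carrier A) \<Longrightarrow>
      S f (map \<pi> xs) = kop E f (map h xs) \<ominus>\<^bsub>E\<^esub> h (oper A f xs)"
  shows cobounding_affine: "fibrewise_affine h"
    and restr_cobounding: "r h \<in> carrier (Hom0_group ar B E)"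
    and cobounding_transgr: "\<And>f qs. qs \<in> tuples (ar f) (carrier Q) \<Longrightarrow>
      S f qs \<oplus>\<^bsub>E\<^esub> r h (T f qs) = E.cobdry Q (\<lambda>q. h (pt \<zero>\<^bsub>B\<^esub> q)) f qs"
proof -
  have hc': "h a \<in> carrier E" if "a \<in> carrier A" for a using hc that by blast
  show aff: "fibrewise_affine h"
    unfolding fibrewise_affine_def
  proof (intro conjI ballI impI hc)
    fix a a' a'' assume a: "a \<in> carrier A" "a' \<in> carrier A" "a'' \<in> carrier A" "\<pi> a = \<pi> a'"
    have xs: "[a, a', a''] \<in> tuples (ar m) (carrier A)" using a ar_m by (auto simp: tuples_def)
    have z: "\<zero>\<^bsub>E\<^esub> = (h a \<ominus>\<^bsub>E\<^esub> h a' \<oplus>\<^bsub>E\<^esub> h a'') \<ominus>\<^bsub>E\<^esub> h (oper A m [a, a', a''])"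
      using hS[OF xs] Sm[of "\<pi> a'" "\<pi> a''"] a by (simp add: E.kop_m hc' \<pi>_closed)
    have "h (oper A m [a, a', a'']) \<in> carrier E" by (rule hc'[OF oper_closed[OF A_alg xs]])
    then show "h (oper A m [a, a', a'']) = h a \<ominus>\<^bsub>E\<^esub> h a' \<oplus>\<^bsub>E\<^esub> h a''"
      using a hc' by (intro E.minus_eq_zeroD[OF _ _ z[symmetric], symmetric]) auto
  qed
  note rc = restr_closed[OF aff]
  let ?k = "\<lambda>q. h (pt \<zero>\<^bsub>B\<^esub> q)"
  have kc: "?k q \<in> carrier E" if "q \<in> carrier Q" for q using that by (simp add: hc' pt)
  \<comment> \<open>The hypothesis on \<open>S\<close> with the splitting of \<open>h\<close>
    substituted in both places and the kernel coordinate of \<open>oper A f xs\<close> expanded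
    additively.\<close>
  have main: "S f (map \<pi> xs) = (kop E f (map (\<lambda>a. r h (\<beta> a)) xs) \<oplus>\<^bsub>E\<^esub> kop E f (map ?k (map \<pi> xs))) \<ominus>\<^bsub>E\<^esub>
      (r h (kop B f (map \<beta> xs)) \<oplus>\<^bsub>E\<^esub> (r h (T f (map \<pi> xs)) \<oplus>\<^bsub>E\<^esub> ?k (oper Q f (map \<pi> xs))))"
    if xs: "xs \<in> tuples (ar f) (carrier A)" for f xs
  proof -
    have qs: "map \<pi> xs \<in> tuples (ar f) (carrier Q)" using xs \<pi>_closed by (rule tuples_map)
    have bs: "map \<beta> xs \<in> tuples (ar f) (carrier B)" using xs \<beta>_closed by (rule tuples_map)
    have h_eq: "map h xs = map (\<lambda>a. r h (\<beta> a) \<oplus>\<^bsub>E\<^esub> ?k (\<pi> a)) xs"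
    proof (rule map_cong[OF refl])
      fix a assume "a \<in> set xs"
      then have "a \<in> carrier A" using xs by (auto simp: tuples_def)
      then show "h a = r h (\<beta> a) \<oplus>\<^bsub>E\<^esub> ?k (\<pi> a)" by (rule restr_split[OF aff])
    qed
    have "kop E f (map h xs) = kop E f (map (\<lambda>a. r h (\<beta> a)) xs) \<oplus>\<^bsub>E\<^esub> kop E f (map (\<lambda>a. ?k (\<pi> a)) xs)"
      unfolding h_eq by (rule E.kop_add[OF xs]) (auto intro!: rc kc \<beta>_closed \<pi>_closed)
    moreover have "h (oper A f xs) = r h (kop B f (map \<beta> xs)) \<oplus>\<^bsub>E\<^esub> (r h (T f (map \<pi> xs)) \<oplus>\<^bsub>E\<^esub> ?k (oper Q f (map \<pi> xs)))"
      using restr_split[OF aff oper_closed[OF A_alg xs]] restr_add[OF aff] rc kc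
        T_closed[OF qs] B.kop_closed[OF bs] oper_closed[OF Q_alg qs]
      by (simp add: \<psi>_oper[OF xs] E.M.a_assoc)
    ultimately show ?thesis using hS[OF xs] by (simp add: comp_def)
  qed
  have Sq: "S f qs = kop E f (map ?k qs) \<ominus>\<^bsub>E\<^esub> (r h (T f qs) \<oplus>\<^bsub>E\<^esub> ?k (oper Q f qs))"
    if qs: "qs \<in> tuples (ar f) (carrier Q)" for f qs
  proof -
    \<comment> \<open>Lifts with first coordinate zero make both terms that come from the kernel
      operation \<open>kop B f\<close> vanish.\<close>
    let ?xs = "map (pt \<zero>\<^bsub>B\<^esub>) qs"
    have xs: "?xs \<in> tuples (ar f) (carrier A)" using qs by (rule tuples_map) (simp add: pt)
    have "map \<beta> ?xs = map (\<lambda>_. \<zero>\<^bsub>B\<^esub>) qs" "map \<pi> ?xs = qs"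
      "map (\<lambda>a. r h (\<beta> a)) ?xs = map (\<lambda>_. \<zero>\<^bsub>E\<^esub>) qs"
      using qs by (auto simp: tuples_def pt subset_iff restr_zero[OF aff] intro!: map_idI)
    with main[OF xs] show ?thesis
      using rc kc qs T_closed[OF qs] oper_closed[OF Q_alg qs] E.kop_map_closed[OF qs kc]
      by (simp add: E.kop_zero[OF qs] B.kop_zero[OF qs] restr_zero[OF aff] del: map_map)
  qed
  show "S f qs \<oplus>\<^bsub>E\<^esub> r h (T f qs) = E.cobdry Q ?k f qs" if qs: "qs \<in> tuples (ar f) (carrier Q)" for f qs
    using Sq[OF qs] qs rc kc T_closed[OF qs] oper_closed[OF Q_alg qs] E.kop_map_closed[OF qs kc]
    by (simp add: E.cobdry_def a_minus_def E.M.minus_add E.M.a_assoc E.M.a_comm[of "\<ominus>\<^bsub>E\<^esub> ?k (oper Q f qs)"] E.M.l_neg)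
       (simp add: E.M.a_ac E.M.r_neg1 E.M.r_neg2 E.M.l_neg)
  have "r h (kop B f bs) = kop E f (map (r h) bs)" if bs: "bs \<in> tuples (ar f) (carrier B)" for f bs
  proof -
    obtain q where q: "q \<in> carrier Q" using Q_alg by (auto simp: is_algebra_def)
    \<comment> \<open>All entries are lifted into a single fibre, so the tuple \<open>?qs\<close>,
      and with it the value of \<open>S\<close>, depends only on the length of
      \<open>bs\<close>.\<close>
    let ?xs = "map (\<lambda>b. pt b q) bs" and ?qs = "map (\<lambda>b. q) bs"
    have xs: "?xs \<in> tuples (ar f) (carrier A)" using bs by (rule tuples_map) (simp add: pt q)
    have qs: "?qs \<in> tuples (ar f) (carrier Q)" using bs by (rule tuples_map) (simp add: q)
    have e: "map \<beta> ?xs = bs" "map \<pi> ?xs = ?qs" "map (\<lambda>a. r h (\<beta> a)) ?xs = map (r h) bs"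
      using bs by (auto simp: tuples_def pt subset_iff q intro!: map_idI)
    let ?x = "kop E f (map (r h) bs)" and ?y = "kop E f (map ?k ?qs)"
      and ?z = "r h (kop B f bs)" and ?w = "r h (T f ?qs) \<oplus>\<^bsub>E\<^esub> ?k (oper Q f ?qs)"
    have c: "?x \<in> carrier E" "?y \<in> carrier E" "?z \<in> carrier E" "?w \<in> carrier E"
      using rc kc bs qs T_closed[OF qs] oper_closed[OF Q_alg qs] E.kop_map_closed[OF qs kc]
        E.kop_map_closed[OF bs rc] B.kop_closed by auto
    \<comment> \<open>\<open>main\<close> and \<open>Sq\<close> compute the same value
      \<open>S f ?qs\<close>; their difference isolates the failure of \<open>r h\<close> to commute
      with \<open>f\<close>, which is therefore zero.\<close>
    have "(?x \<ominus>\<^bsub>E\<^esub> ?z) \<oplus>\<^bsub>E\<^esub> (?y \<ominus>\<^bsub>E\<^esub> ?w) = ?y \<ominus>\<^bsub>E\<^esub> ?w"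
      using main[OF xs] Sq[OF qs] c unfolding e by (simp add: E.minus_add_add del: map_map)
    then have "?x \<ominus>\<^bsub>E\<^esub> ?z = \<zero>\<^bsub>E\<^esub>" using c E.M.add.r_cancel_one[of "?y \<ominus>\<^bsub>E\<^esub> ?w" "?x \<ominus>\<^bsub>E\<^esub> ?z"] E.M.minus_closed by blast
    then show ?thesis using c E.minus_eq_zeroD[of ?x ?z] by simp
  qed
  moreover have "is_algebra ar (alg B)" using B.E_variety by (rule in_variety_algebra)
  ultimately have "(\<lambda>b\<in>carrier (alg B). r h b) \<in> carrier (Hom_group ar (alg B) E)"
    using rc by (intro E.alg_homI) (auto simp: alg_def)
  moreover have "(\<lambda>b\<in>carrier (alg B). r h b) = r h" by (auto simp: alg_def restr_def)
  ultimately show "r h \<in> carrier (Hom0_group ar B E)"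
    by (simp add: Hom0_group_def restr_zero[OF aff])
qed

text \<open>Additivity follows from preservation of \<open>m\<close> and of zero, since b + b' =
  m(b,0,b') in both kernel algebras.\<close>

lemma Hom0_D:
  assumes "\<phi> \<in> carrier (Hom0_group ar B E)"
  shows "b \<in> carrier B \<Longrightarrow> \<phi> b \<in> carrier E" and "\<phi> \<zero>\<^bsub>B\<^esub> = \<zero>\<^bsub>E\<^esub>"
    and "bs \<in> tuples (ar f) (carrier B) \<Longrightarrow> \<phi> (kop B f bs) = kop E f (map \<phi> bs)"
    and "b \<in> carrier B \<Longrightarrow> b' \<in> carrier B \<Longrightarrow> \<phi> (b \<oplus>\<^bsub>B\<^esub> b') = \<phi> b \<oplus>\<^bsub>E\<^esub> \<phi> b'"
    and "\<phi> \<in> extensional (carrier B)"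
proof -
  have \<phi>: "\<phi> \<in> carrier (Hom_group ar (alg B) E)" and z: "\<phi> \<zero>\<^bsub>B\<^esub> = \<zero>\<^bsub>E\<^esub>"
    using assms by (auto simp: Hom0_group_def)
  show c: "\<phi> b \<in> carrier E" if "b \<in> carrier B" for b
    using E.Hom_groupD(1)[OF \<phi>] that by (simp add: alg_def)
  show k: "\<phi> (kop B f bs) = kop E f (map \<phi> bs)" if "bs \<in> tuples (ar f) (carrier B)" for f bs
    using E.Hom_groupD(2)[OF \<phi>] that by (simp add: alg_def)
  show "\<phi> (b \<oplus>\<^bsub>B\<^esub> b') = \<phi> b \<oplus>\<^bsub>E\<^esub> \<phi> b'" if b: "b \<in> carrier B" "b' \<in> carrier B"
  proof -
    have "[b, \<zero>\<^bsub>B\<^esub>, b'] \<in> tuples (ar m) (carrier B)" using b ar_m by (auto simp: tuples_def)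
    from k[OF this] show ?thesis using b c[of b] c[of b'] by (simp add: B.kop_m E.kop_m z a_minus_def B.uminus_zero E.uminus_zero)
  qed
  show "\<phi> \<in> extensional (carrier B)" using E.Hom_groupD(3)[OF \<phi>] by (simp add: alg_def)
qed (use assms in \<open>auto simp: Hom0_group_def\<close>)

text \<open>Since \<open>\<phi>\<close> is additive and commutes with \<open>f\<close>, the part
  depending on first coordinates cancels, and what remains is computed in \<open>Q\<close>. This is
  the converse of the splitting: it produces homomorphisms on \<open>A\<close> from solutions of an
  equation on \<open>Q\<close>.\<close>

lemma split_cobounding:
  assumes \<phi>: "\<phi> \<in> carrier (Hom0_group ar B E)" and k: "\<And>q. q \<in> carrier Q \<Longrightarrow> k q \<in> carrier E"
    and xs: "xs \<in> tuples (ar f) (carrier A)"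
  defines "h \<equiv> \<lambda>a. \<phi> (\<beta> a) \<oplus>\<^bsub>E\<^esub> k (\<pi> a)"
  shows "kop E f (map h xs) \<ominus>\<^bsub>E\<^esub> h (oper A f xs) =
    E.cobdry Q k f (map \<pi> xs) \<ominus>\<^bsub>E\<^esub> \<phi> (T f (map \<pi> xs))"
proof -
  note \<phi>c = Hom0_D(1)[OF \<phi>]
  have qs: "map \<pi> xs \<in> tuples (ar f) (carrier Q)" using xs \<pi>_closed by (rule tuples_map)
  have bs: "map \<beta> xs \<in> tuples (ar f) (carrier B)" using xs \<beta>_closed by (rule tuples_map)
  have 1: "kop E f (map h xs) = \<phi> (kop B f (map \<beta> xs)) \<oplus>\<^bsub>E\<^esub> kop E f (map k (map \<pi> xs))"
    unfolding h_def
    using E.kop_add[OF xs, of "\<lambda>a. \<phi> (\<beta> a)" "\<lambda>a. k (\<pi> a)"] \<phi>c k \<beta>_closed \<pi>_closed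
    by (simp add: Hom0_D(3)[OF \<phi> bs] comp_def)
  have 2: "h (oper A f xs) = \<phi> (kop B f (map \<beta> xs)) \<oplus>\<^bsub>E\<^esub> (\<phi> (T f (map \<pi> xs)) \<oplus>\<^bsub>E\<^esub> k (oper Q f (map \<pi> xs)))"
    unfolding h_def \<psi>_oper[OF xs]
    using T_closed[OF qs] B.kop_closed[OF bs] \<phi>c k[OF oper_closed[OF Q_alg qs]]
    by (simp add: Hom0_D(4)[OF \<phi>] E.M.a_assoc)
  have c: "\<phi> (kop B f (map \<beta> xs)) \<in> carrier E" "kop E f (map k (map \<pi> xs)) \<in> carrier E"
    "\<phi> (T f (map \<pi> xs)) \<in> carrier E" "k (oper Q f (map \<pi> xs)) \<in> carrier E"
    using T_closed[OF qs] B.kop_closed[OF bs] \<phi>c k[OF oper_closed[OF Q_alg qs]] E.kop_map_closed[OF qs k] by auto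
  show ?thesis
    unfolding 1 2 using c qs by (simp add: E.add_minus_add_cancel E.cobdry_def del: map_map)
qed

end

section \<open>The exact sequence\<close>

context realized_extension
begin

section \<open>The groups of the sequence\<close>

abbreviation "HQ \<equiv> Hom_group ar Q E"
abbreviation "HA \<equiv> Hom_group ar A E"
abbreviation "HB \<equiv> Hom0_group ar B E"
abbreviation "ZQ \<equiv> Z2_group ar Eqs Q E"
abbreviation "ZA \<equiv> Z2_group ar Eqs A E"
abbreviation "H2Q \<equiv> H2_group ar Eqs Q E"
abbreviation "H2A \<equiv> H2_group ar Eqs A E"
abbreviation "classQ \<equiv> H2_class ar Eqs Q E"
abbreviation "classA \<equiv> H2_class ar Eqs A E"

lemmas comm_group_HQ = E.comm_group_Hom_group[OF Q_alg]
  and comm_group_HA = E.comm_group_Hom_group[OF A_alg]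
  and comm_group_H2Q = E.comm_group_H2[OF Q_variety]
  and comm_group_H2A = E.comm_group_H2[OF A_variety]

lemma comm_group_HB: "comm_group HB"
proof -
  let ?H = "Hom_group ar (alg B) E" and ?C = "{\<phi> \<in> carrier (Hom_group ar (alg B) E). \<phi> \<zero>\<^bsub>B\<^esub> = \<zero>\<^bsub>E\<^esub>}"
  interpret H: comm_group ?H by (rule E.comm_group_Hom_group[OF in_variety_algebra[OF B.E_variety]])
  have 0: "\<zero>\<^bsub>B\<^esub> \<in> carrier (alg B)" by (simp add: alg_def)
  have "subgroup ?C ?H"
  proof (rule H.subgroupI)
    have "\<one>\<^bsub>?H\<^esub> \<in> ?C" using H.one_closed 0 by (simp add: E.Hom_group_simps)
    then show "?C \<noteq> {}" by blast
    show "inv\<^bsub>?H\<^esub> \<phi> \<in> ?C" if \<phi>: "\<phi> \<in> ?C" for \<phi>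
    proof -
      \<comment> \<open>Evaluating the inverse law at zero shows that the inverse also preserves
        zero.\<close>
      have "inv\<^bsub>?H\<^esub> \<phi> \<otimes>\<^bsub>?H\<^esub> \<phi> = \<one>\<^bsub>?H\<^esub>" using \<phi> by simp
      from fun_cong[OF this, of "\<zero>\<^bsub>B\<^esub>"] have "(inv\<^bsub>?H\<^esub> \<phi>) \<zero>\<^bsub>B\<^esub> = \<zero>\<^bsub>E\<^esub>"
        using \<phi> 0 E.Hom_groupD(1)[OF H.inv_closed 0] by (simp add: E.Hom_group_simps)
      then show ?thesis using \<phi> by simp
    qed
    show "\<phi> \<otimes>\<^bsub>?H\<^esub> \<chi> \<in> ?C" if \<phi>: "\<phi> \<in> ?C" "\<chi> \<in> ?C" for \<phi> \<chi>
      using H.m_closed[of \<phi> \<chi>] \<phi> 0 by (simp add: E.Hom_group_simps)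
  qed auto
  from subgroup.subgroup_is_group[OF this H.is_group] have "group HB" by (simp add: Hom0_group_def)
  then show ?thesis
    by (rule group.group_comm_groupI) (simp add: Hom0_group_def H.m_comm)
qed

lemma map_\<pi>_tuple: "xs \<in> tuples n (carrier A) \<Longrightarrow> map \<pi> xs \<in> tuples n (carrier Q)"
  by (erule tuples_map) (rule \<pi>_closed)

lemma HB_simps:
  "mult HB = (\<lambda>\<phi> \<chi>. \<lambda>b\<in>carrier B. \<phi> b \<oplus>\<^bsub>E\<^esub> \<chi> b)" "one HB = (\<lambda>b\<in>carrier B. \<zero>\<^bsub>E\<^esub>)"
  by (simp_all add: Hom0_group_def Hom_group_def alg_def)

section \<open>Inflation and restriction of homomorphisms\<close>

lemma infl_Hom_hom: "infl_Hom A \<pi> \<in> hom HQ HA"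
proof (rule homI)
  show "infl_Hom A \<pi> \<phi> \<in> carrier HA" if \<phi>: "\<phi> \<in> carrier HQ" for \<phi>
    unfolding infl_Hom_def
  proof (rule E.alg_homI[OF A_alg])
    show "\<phi> (\<pi> (oper A f xs)) = kop E f (map (\<lambda>a. \<phi> (\<pi> a)) xs)"
      if xs: "xs \<in> tuples (ar f) (carrier A)" for f xs
      using E.Hom_groupD(2)[OF \<phi> map_\<pi>_tuple[OF xs]] by (simp add: \<psi>_oper[OF xs] comp_def)
  qed (simp add: E.Hom_groupD[OF \<phi>] \<pi>_closed)
qed (auto simp: infl_Hom_def E.Hom_group_simps \<pi>_closed intro!: restrict_ext)

text \<open>Each \<open>q\<close> is the image under \<open>\<pi>\<close> of the base point over it,
  so \<open>\<phi>\<close> is recovered from its inflation.\<close>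

lemma infl_Hom_kernel: "kernel HQ HA (infl_Hom A \<pi>) = {\<one>\<^bsub>HQ\<^esub>}"
proof -
  interpret HQ: comm_group HQ by (rule comm_group_HQ)
  interpret HA: comm_group HA by (rule comm_group_HA)
  have "\<phi> = \<one>\<^bsub>HQ\<^esub>" if \<phi>: "\<phi> \<in> carrier HQ" and z: "infl_Hom A \<pi> \<phi> = \<one>\<^bsub>HA\<^esub>" for \<phi>
  proof (rule E.Hom_group_eqI[OF \<phi> HQ.one_closed])
    show "\<phi> q = \<one>\<^bsub>HQ\<^esub> q" if q: "q \<in> carrier Q" for q
      using fun_cong[OF z, of "pt \<zero>\<^bsub>B\<^esub> q"] q by (simp add: infl_Hom_def E.Hom_group_simps pt)
  qed
  moreover have "infl_Hom A \<pi> \<one>\<^bsub>HQ\<^esub> = \<one>\<^bsub>HA\<^esub>"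
    using hom_one[OF infl_Hom_hom HQ.is_group HA.is_group] .
  ultimately show ?thesis by (auto simp: kernel_def)
qed

text \<open>A homomorphism is a function with vanishing coboundary, so these are the instances of
  the splitting results for the zero family.\<close>

lemma
  assumes h: "h \<in> carrier HA"
  shows HA_affine: "fibrewise_affine h" and restr_closed_HB: "r h \<in> carrier HB"
    and HA_transgr: "\<And>f qs. qs \<in> tuples (ar f) (carrier Q) \<Longrightarrow>
      r h (T f qs) = E.cobdry Q (\<lambda>q. h (pt \<zero>\<^bsub>B\<^esub> q)) f qs"
proof -
  have hc: "h \<in> carrier A \<rightarrow> carrier E" using E.Hom_groupD(1)[OF h] by auto
  have hS: "\<zero>\<^bsub>E\<^esub> = kop E f (map h xs) \<ominus>\<^bsub>E\<^esub> h (oper A f xs)"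
    if xs: "xs \<in> tuples (ar f) (carrier A)" for f xs
    using E.Hom_groupD(2)[OF h xs] E.kop_map_closed[OF xs E.Hom_groupD(1)[OF h]]
    by (simp add: a_minus_def E.M.r_neg)
  note c = cobounding_affine[OF _ _ hc, of "\<lambda>_ _. \<zero>\<^bsub>E\<^esub>"] restr_cobounding[OF _ _ hc, of "\<lambda>_ _. \<zero>\<^bsub>E\<^esub>"]
    cobounding_transgr[OF _ _ hc, of "\<lambda>_ _. \<zero>\<^bsub>E\<^esub>"]
  show aff: "fibrewise_affine h" by (rule c(1)) (use hS in auto)
  show "r h \<in> carrier HB" by (rule c(2)) (use hS in auto)
  show "r h (T f qs) = E.cobdry Q (\<lambda>q. h (pt \<zero>\<^bsub>B\<^esub> q)) f qs"
    if qs: "qs \<in> tuples (ar f) (carrier Q)" for f qs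
  proof -
    have "\<zero>\<^bsub>E\<^esub> \<oplus>\<^bsub>E\<^esub> r h (T f qs) = E.cobdry Q (\<lambda>q. h (pt \<zero>\<^bsub>B\<^esub> q)) f qs"
      by (rule c(3)) (use hS qs in auto)
    then show ?thesis using restr_closed[OF aff T_closed[OF qs]] by simp
  qed
qed

lemma restr_hom: "r \<in> hom HA HB"
proof (rule homI)
  interpret HA: comm_group HA by (rule comm_group_HA)
  show "r (h \<otimes>\<^bsub>HA\<^esub> k) = r h \<otimes>\<^bsub>HB\<^esub> r k" if hk: "h \<in> carrier HA" "k \<in> carrier HA" for h k
  proof
    fix b
    obtain q where q: "q \<in> carrier Q" using Q_alg by (auto simp: is_algebra_def)
    show "r (h \<otimes>\<^bsub>HA\<^esub> k) b = (r h \<otimes>\<^bsub>HB\<^esub> r k) b"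
    proof (cases "b \<in> carrier B")
      case True
      then show ?thesis
        using hk q HA_affine E.Hom_groupD(1)[OF hk(1)] E.Hom_groupD(1)[OF hk(2)]
        by (simp add: restr_eq[OF _ _ q] HB_simps pt)
           (simp add: E.Hom_group_simps pt E.minus_add_add)
    qed (simp add: restr_def HB_simps)
  qed
qed (rule restr_closed_HB)

text \<open>An inflated map is constant on fibres, so its restriction vanishes. Conversely, if the
  restriction vanishes, \<open>restr_split\<close> leaves only the function of the second
  coordinate, and \<open>HA_transgr\<close> shows that this function is a homomorphism on
  \<open>Q\<close>.\<close>

lemma exact_at_HA: "infl_Hom A \<pi> ` carrier HQ = kernel HA HB r"
proof (intro equalityI subsetI)
  obtain q where q: "q \<in> carrier Q" using Q_alg by (auto simp: is_algebra_def)
  fix h assume "h \<in> infl_Hom A \<pi> ` carrier HQ"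
  then obtain \<phi> where \<phi>: "\<phi> \<in> carrier HQ" and h: "h = infl_Hom A \<pi> \<phi>" by blast
  have hA: "h \<in> carrier HA" using hom_in_carrier[OF infl_Hom_hom \<phi>] h by simp
  have "r h b = \<zero>\<^bsub>E\<^esub>" if b: "b \<in> carrier B" for b
    using restr_eq[OF HA_affine[OF hA] b q] b q E.Hom_groupD(1)[OF \<phi> q]
    by (simp add: h infl_Hom_def pt a_minus_def E.M.r_neg)
  then have "r h = \<one>\<^bsub>HB\<^esub>" by (auto simp: HB_simps restr_def intro!: restrict_ext)
  then show "h \<in> kernel HA HB r" using hA by (simp add: kernel_def)
next
  fix h assume "h \<in> kernel HA HB r"
  then have hA: "h \<in> carrier HA" and r0: "r h = \<one>\<^bsub>HB\<^esub>" by (auto simp: kernel_def)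
  note hc = E.Hom_groupD(1)[OF hA]
  have r0': "r h b = \<zero>\<^bsub>E\<^esub>" if "b \<in> carrier B" for b using r0 that by (simp add: HB_simps)
  let ?k = "\<lambda>q. h (pt \<zero>\<^bsub>B\<^esub> q)"
  have kc: "?k q \<in> carrier E" if "q \<in> carrier Q" for q using that by (simp add: hc pt)
  have k: "(\<lambda>q\<in>carrier Q. ?k q) \<in> carrier HQ"
  proof (rule E.alg_homI[OF Q_alg kc])
    show "?k (oper Q f qs) = kop E f (map ?k qs)" if qs: "qs \<in> tuples (ar f) (carrier Q)" for f qs
    proof -
      \<comment> \<open>The coboundary of \<open>?k\<close> is \<open>r h\<close> composed with
        \<open>T\<close>, hence zero; a function with zero coboundary is a homomorphism.\<close>
      have z: "kop E f (map ?k qs) \<ominus>\<^bsub>E\<^esub> ?k (oper Q f qs) = \<zero>\<^bsub>E\<^esub>"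
        using HA_transgr[OF hA qs] r0'[OF T_closed[OF qs]] qs by (simp add: E.cobdry_def)
      have "kop E f (map ?k qs) \<in> carrier E" by (rule E.kop_map_closed[OF qs]) (rule kc)
      then show ?thesis
        using E.minus_eq_zeroD[OF _ _ z] kc[OF oper_closed[OF Q_alg qs]] by simp
    qed
  qed
  have "h = infl_Hom A \<pi> (\<lambda>q\<in>carrier Q. ?k q)"
  proof (rule E.Hom_group_eqI[OF hA hom_in_carrier[OF infl_Hom_hom k]])
    show "h a = infl_Hom A \<pi> (\<lambda>q\<in>carrier Q. ?k q) a" if a: "a \<in> carrier A" for a
      using restr_split[OF HA_affine[OF hA] a] a kc[OF \<pi>_closed[OF a]]
      by (simp add: infl_Hom_def \<pi>_closed r0' \<beta>_closed)
  qed
  then show "h \<in> infl_Hom A \<pi> ` carrier HQ" using k by (rule image_eqI)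
qed

section \<open>Transgression\<close>

definition push :: "('b \<Rightarrow> 'e) \<Rightarrow> 'f \<Rightarrow> 'q list \<Rightarrow> 'e" where
  "push \<phi> = (\<lambda>f. \<lambda>qs\<in>tuples (ar f) (carrier Q). \<phi> (T f qs))"

lemma transgr_eq: "transgr ar Eqs Q E T = classQ \<circ> push"
  by (simp add: transgr_def[abs_def] push_def[abs_def] comp_def)

text \<open>\<open>\<phi>\<close> preserves zero, sums and operations, so it passes through the
  recursion for correction terms. Compatibility of \<open>T\<close> therefore carries over to its
  composite with \<open>\<phi>\<close>.\<close>

lemma dterm_push:
  assumes \<phi>: "\<phi> \<in> carrier HB" and \<rho>: "\<And>x. \<rho> x \<in> carrier Q" and t: "t \<in> terms ar UNIV"
  shows "dterm E (push \<phi>) Q \<rho> t = \<phi> (dterm B T Q \<rho> t)"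
  using t
proof induction
  case (terms_App ts f)
  then have app: "App f ts \<in> terms ar UNIV" by (auto intro: terms.terms_App)
  have ts: "ts \<in> tuples (ar f) (terms ar UNIV)" using terms_App by (auto simp: tuples_def)
  note ev = eval_tuple[OF Q_alg app \<rho>]
  have d: "map (dterm B T Q \<rho>) ts \<in> tuples (ar f) (carrier B)"
    using ts by (rule tuples_map) (rule B.dterm_closed[OF Q_alg \<rho> _ T_closed])
  have "map (dterm E (push \<phi>) Q \<rho>) ts = map \<phi> (map (dterm B T Q \<rho>) ts)"
    using terms_App by auto
  moreover have "push \<phi> f (map (eval Q \<rho>) ts) = \<phi> (T f (map (eval Q \<rho>) ts))"
    using ev by (simp add: push_def)
  ultimately show ?case
    by (simp add: Hom0_D(4)[OF \<phi> B.kop_closed[OF d] T_closed[OF ev]] Hom0_D(3)[OF \<phi> d] del: map_map)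
qed (simp add: Hom0_D(2)[OF \<phi>])

lemma push_hom: "push \<in> hom HB ZQ"
proof (rule homI)
  show "push \<phi> \<in> carrier ZQ" if \<phi>: "\<phi> \<in> carrier HB" for \<phi>
  proof -
    have "is_compatible ar Eqs Q E (push \<phi>)"
      unfolding is_compatible_def
    proof clarify
      fix s t :: "('f, nat) trm" and \<rho> :: "nat \<Rightarrow> 'q"
      assume st: "(s, t) \<in> identities ar Eqs (UNIV :: nat set)" and \<rho>: "\<forall>x. \<rho> x \<in> carrier Q"
      have "dterm B T Q \<rho> s = dterm B T Q \<rho> t"
        using realizes \<rho> by (intro B.compatibleD[OF _ st]) (auto simp: realizes_via_def)
      moreover have "s \<in> terms ar UNIV" "t \<in> terms ar UNIV" using st by (auto simp: identities_def)
      ultimately show "dterm E (push \<phi>) Q \<rho> s = dterm E (push \<phi>) Q \<rho> t"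
        using \<rho> by (simp add: dterm_push[OF \<phi>])
    qed
    moreover have "push \<phi> \<in> cocycles ar Q E"
      unfolding push_def by (intro E.cocyclesI Hom0_D(1)[OF \<phi>] T_closed)
    ultimately show ?thesis by (simp add: E.Z2_group_simps)
  qed
  show "push (\<phi> \<otimes>\<^bsub>HB\<^esub> \<chi>) = push \<phi> \<otimes>\<^bsub>ZQ\<^esub> push \<chi>" for \<phi> \<chi>
    by (auto simp: push_def HB_simps E.Z2_group_simps T_closed intro!: ext restrict_ext)
qed

lemma transgr_hom: "transgr ar Eqs Q E T \<in> hom HB H2Q"
  unfolding transgr_eq by (rule hom_compose[OF push_hom E.H2_class_hom[OF Q_variety]])

lemma transgr_eq_one_iff:
  "\<phi> \<in> carrier HB \<Longrightarrow> transgr ar Eqs Q E T \<phi> = \<one>\<^bsub>H2Q\<^esub> \<longleftrightarrow> push \<phi> \<in> coboundaries ar Q E"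
  unfolding transgr_eq comp_def
  by (rule E.H2_class_eq_one_iff[OF Q_variety hom_in_carrier[OF push_hom]])

text \<open>For a restriction \<open>r h\<close>, \<open>HA_transgr\<close> exhibits the pushed
  cocycle as the coboundary of \<open>h\<close> along the base points. Conversely, a function
  \<open>k\<close> cobounding the pushed cocycle supplies exactly the second summand that extends
  \<open>\<phi>\<close> to a homomorphism on \<open>A\<close>.\<close>

lemma exact_at_HB: "r ` carrier HA = kernel HB H2Q (transgr ar Eqs Q E T)"
proof (intro equalityI subsetI)
  fix \<phi> assume "\<phi> \<in> r ` carrier HA"
  then obtain h where h: "h \<in> carrier HA" and \<phi>: "\<phi> = r h" by blast
  let ?k = "\<lambda>q. h (pt \<zero>\<^bsub>B\<^esub> q)"
  have "push \<phi> = E.cobdry Q ?k"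
    unfolding push_def \<phi> E.cobdry_def
    by (intro ext restrict_ext) (simp add: HA_transgr[OF h] E.cobdry_def)
  moreover have "?k \<in> carrier Q \<rightarrow> carrier E" using E.Hom_groupD(1)[OF h] pt by auto
  ultimately have "push \<phi> \<in> coboundaries ar Q E" by (auto simp: E.coboundaries_eq)
  then show "\<phi> \<in> kernel HB H2Q (transgr ar Eqs Q E T)"
    using restr_closed_HB[OF h] \<phi> by (simp add: kernel_def transgr_eq_one_iff)
next
  fix \<phi> assume "\<phi> \<in> kernel HB H2Q (transgr ar Eqs Q E T)"
  then have \<phi>: "\<phi> \<in> carrier HB" and "push \<phi> \<in> coboundaries ar Q E"
    by (auto simp: kernel_def transgr_eq_one_iff)
  then obtain k where k: "k \<in> carrier Q \<rightarrow> carrier E" and pk: "push \<phi> = E.cobdry Q k"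
    by (auto simp: E.coboundaries_eq)
  have kc: "k q \<in> carrier E" if "q \<in> carrier Q" for q using k that by blast
  \<comment> \<open>By \<open>split_cobounding\<close> the coboundary of this candidate is that of
    \<open>k\<close> minus the pushed cocycle, and the two are equal. Its restriction is
    \<open>\<phi>\<close> because \<open>\<phi>\<close> preserves zero and the \<open>k\<close>
    summands cancel within a fibre.\<close>
  let ?h = "\<lambda>a. \<phi> (\<beta> a) \<oplus>\<^bsub>E\<^esub> k (\<pi> a)"
  have hc: "?h a \<in> carrier E" if "a \<in> carrier A" for a
    using that by (simp add: Hom0_D(1)[OF \<phi>] kc \<beta>_closed \<pi>_closed)
  have h: "(\<lambda>a\<in>carrier A. ?h a) \<in> carrier HA"
  proof (rule E.alg_homI[OF A_alg hc])
    show "?h (oper A f xs) = kop E f (map ?h xs)" if xs: "xs \<in> tuples (ar f) (carrier A)" for f xs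
    proof -
      have qs: "map \<pi> xs \<in> tuples (ar f) (carrier Q)" by (rule map_\<pi>_tuple[OF xs])
      have "E.cobdry Q k f (map \<pi> xs) = \<phi> (T f (map \<pi> xs))"
        using fun_cong[OF fun_cong[OF pk, of f], of "map \<pi> xs"] qs by (simp add: push_def)
      then have z: "kop E f (map ?h xs) \<ominus>\<^bsub>E\<^esub> ?h (oper A f xs) = \<zero>\<^bsub>E\<^esub>"
        using split_cobounding[where k = k, OF \<phi> kc xs] Hom0_D(1)[OF \<phi> T_closed[OF qs]]
        by (simp add: a_minus_def E.M.r_neg)
      have "kop E f (map ?h xs) \<in> carrier E" by (rule E.kop_map_closed[OF xs]) (rule hc)
      then show ?thesis
        using E.minus_eq_zeroD[OF _ _ z] hc[OF oper_closed[OF A_alg xs]] by simp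
    qed
  qed
  have "\<phi> b = r (\<lambda>a\<in>carrier A. ?h a) b" for b
  proof (cases "b \<in> carrier B")
    case True
    obtain q where q: "q \<in> carrier Q" using Q_alg by (auto simp: is_algebra_def)
    show ?thesis
      using Hom0_D(1)[OF \<phi> True] kc[OF q] True q
      by (simp add: restr_eq[OF HA_affine[OF h] True q] pt Hom0_D(2)[OF \<phi>] a_minus_def E.M.a_assoc E.M.r_neg)
  next
    case False
    then show ?thesis using Hom0_D(5)[OF \<phi>] by (simp add: restr_def extensional_def)
  qed
  then have "\<phi> = r (\<lambda>a\<in>carrier A. ?h a)" by (rule ext)
  then show "\<phi> \<in> r ` carrier HA" using h by (rule image_eqI)
qed

section \<open>Inflation on cohomology\<close>

definition pull :: "('f \<Rightarrow> 'q list \<Rightarrow> 'e) \<Rightarrow> 'f \<Rightarrow> 'a list \<Rightarrow> 'e" where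
  "pull S = (\<lambda>f. \<lambda>xs\<in>tuples (ar f) (carrier A). S f (map \<pi> xs))"

lemma eval_\<pi>:
  assumes "\<And>x. \<rho> x \<in> carrier A" "t \<in> terms ar UNIV"
  shows "eval Q (\<lambda>x. \<pi> (\<rho> x)) t = \<pi> (eval A \<rho> t)"
proof (rule eval_alg_hom[OF A_alg _ assms(2)])
  show "\<pi> \<in> alg_hom ar A Q" by (auto simp: alg_hom_def \<pi>_closed \<psi>_oper)
qed (rule assms(1))

text \<open>Term evaluation commutes with \<open>\<pi>\<close>, so both recursions meet the same
  values of \<open>S\<close>. Compatibility over \<open>Q\<close> hence gives compatibility of the
  pullback over \<open>A\<close>.\<close>

lemma dterm_pull:
  assumes \<rho>: "\<And>x. \<rho> x \<in> carrier A" and t: "t \<in> terms ar UNIV"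
  shows "dterm E (pull S) A \<rho> t = dterm E S Q (\<lambda>x. \<pi> (\<rho> x)) t"
  using t
proof induction
  case (terms_App ts f)
  then have app: "App f ts \<in> terms ar UNIV" by (auto intro: terms.terms_App)
  note ev = eval_tuple[OF A_alg app \<rho>]
  have "map (dterm E (pull S) A \<rho>) ts = map (dterm E S Q (\<lambda>x. \<pi> (\<rho> x))) ts"
    "map (eval Q (\<lambda>x. \<pi> (\<rho> x))) ts = map \<pi> (map (eval A \<rho>) ts)"
    using terms_App by (auto simp: eval_\<pi>[OF \<rho>])
  moreover have "pull S f (map (eval A \<rho>) ts) = S f (map \<pi> (map (eval A \<rho>) ts))"
    using ev by (simp add: pull_def)
  ultimately show ?case by (simp only: dterm.simps)
qed simp

lemma pull_hom: "pull \<in> hom ZQ ZA"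
proof (rule homI)
  show "pull S \<in> carrier ZA" if S: "S \<in> carrier ZQ" for S
  proof -
    have "is_compatible ar Eqs A E (pull S)"
      unfolding is_compatible_def
    proof clarify
      fix s t :: "('f, nat) trm" and \<rho> :: "nat \<Rightarrow> 'a"
      assume st: "(s, t) \<in> identities ar Eqs (UNIV :: nat set)" and \<rho>: "\<forall>x. \<rho> x \<in> carrier A"
      have "dterm E S Q (\<lambda>x. \<pi> (\<rho> x)) s = dterm E S Q (\<lambda>x. \<pi> (\<rho> x)) t"
        using S \<rho> by (intro E.compatibleD[OF _ st]) (auto simp: E.Z2_group_simps \<pi>_closed)
      moreover have "s \<in> terms ar UNIV" "t \<in> terms ar UNIV" using st by (auto simp: identities_def)
      ultimately show "dterm E (pull S) A \<rho> s = dterm E (pull S) A \<rho> t"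
        using \<rho> by (simp add: dterm_pull)
    qed
    moreover have "pull S \<in> cocycles ar A E"
      unfolding pull_def using S
      by (intro E.cocyclesI) (auto simp: E.Z2_group_simps intro!: E.cocycles_closed map_\<pi>_tuple)
    ultimately show ?thesis by (simp add: E.Z2_group_simps)
  qed
  show "pull (S \<otimes>\<^bsub>ZQ\<^esub> S') = pull S \<otimes>\<^bsub>ZA\<^esub> pull S'" for S S'
    by (auto simp: pull_def E.Z2_group_simps map_\<pi>_tuple intro!: ext restrict_ext)
qed

text \<open>A function cobounding on \<open>Q\<close>, composed with \<open>\<pi>\<close>, cobounds
  the pullback. This lets inflation descend to cohomology classes.\<close>

lemma pull_coboundaries: "S \<in> coboundaries ar Q E \<Longrightarrow> pull S \<in> coboundaries ar A E"
proof -
  assume "S \<in> coboundaries ar Q E"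
  then obtain h where h: "h \<in> carrier Q \<rightarrow> carrier E" "S = E.cobdry Q h" by (auto simp: E.coboundaries_eq)
  have "pull S = E.cobdry A (\<lambda>a. h (\<pi> a))"
    unfolding pull_def h E.cobdry_def
    by (intro ext restrict_ext) (simp add: map_\<pi>_tuple \<psi>_oper comp_def)
  moreover have "(\<lambda>a. h (\<pi> a)) \<in> carrier A \<rightarrow> carrier E" using h \<pi>_closed by auto
  ultimately show ?thesis by (auto simp: E.coboundaries_eq)
qed

lemma infl_H2_eq: "infl_H2 ar Eqs A \<pi> E = (\<lambda>C. \<Union>S\<in>C. coboundaries ar A E #>\<^bsub>ZA\<^esub> pull S)"
  by (simp add: infl_H2_def[abs_def] pull_def H2_class_def)

lemma infl_H2_hom: "infl_H2 ar Eqs A \<pi> E \<in> hom H2Q H2A"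
  unfolding infl_H2_eq H2_group_def
  by (intro induced_coset_hom pull_hom pull_coboundaries E.normal_coboundaries Q_variety A_variety
      comm_group.axioms(2) E.comm_group_Z2)

lemma infl_H2_class: "S \<in> carrier ZQ \<Longrightarrow> infl_H2 ar Eqs A \<pi> E (classQ S) = classA (pull S)"
  unfolding infl_H2_eq H2_class_def
  by (intro induced_coset_map pull_hom pull_coboundaries E.normal_coboundaries Q_variety A_variety
      comm_group.axioms(2) E.comm_group_Z2)

lemma infl_H2_class_eq_one_iff:
  "S \<in> carrier ZQ \<Longrightarrow> infl_H2 ar Eqs A \<pi> E (classQ S) = \<one>\<^bsub>H2A\<^esub> \<longleftrightarrow> pull S \<in> coboundaries ar A E"
  by (simp add: infl_H2_class E.H2_class_eq_one_iff[OF A_variety hom_in_carrier[OF pull_hom]])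

text \<open>Over \<open>A\<close> the kernel coordinate itself cobounds the inflated transgression.
  Conversely, if \<open>h\<close> cobounds the pullback of \<open>S\<close>, the splitting shows
  that \<open>S\<close> plus the pushed cocycle of \<open>r h\<close> is a coboundary on
  \<open>Q\<close>, so the class of \<open>S\<close> is minus the transgression of
  \<open>r h\<close>.\<close>

lemma exact_at_H2Q: "transgr ar Eqs Q E T ` carrier HB = kernel H2Q H2A (infl_H2 ar Eqs A \<pi> E)"
proof (intro equalityI subsetI)
  fix C assume "C \<in> transgr ar Eqs Q E T ` carrier HB"
  then obtain \<phi> where \<phi>: "\<phi> \<in> carrier HB" and C: "C = classQ (push \<phi>)" by (auto simp: transgr_eq)
  have pZ: "push \<phi> \<in> carrier ZQ" by (rule hom_in_carrier[OF push_hom \<phi>])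
  \<comment> \<open>The sign is forced: \<open>T\<close> enters the kernel coordinate of
    \<open>oper A f xs\<close> with a plus, so the coboundary of \<open>\<phi>\<close> along
    \<open>\<beta>\<close> is minus the inflated cocycle.\<close>
  let ?h = "\<lambda>a. \<ominus>\<^bsub>E\<^esub> \<phi> (\<beta> a)"
  note \<phi>c = Hom0_D(1)[OF \<phi>]
  have "kop E f (map ?h xs) \<ominus>\<^bsub>E\<^esub> ?h (oper A f xs) = \<phi> (T f (map \<pi> xs))"
    if xs: "xs \<in> tuples (ar f) (carrier A)" for f xs
  proof -
    have qs: "map \<pi> xs \<in> tuples (ar f) (carrier Q)" by (rule map_\<pi>_tuple[OF xs])
    have bs: "map \<beta> xs \<in> tuples (ar f) (carrier B)" using xs \<beta>_closed by (rule tuples_map)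
    have "kop E f (map ?h xs) = \<ominus>\<^bsub>E\<^esub> kop E f (map (\<lambda>a. \<phi> (\<beta> a)) xs)"
      by (rule E.kop_uminus[OF xs]) (simp add: \<phi>c \<beta>_closed)
    also have "kop E f (map (\<lambda>a. \<phi> (\<beta> a)) xs) = \<phi> (kop B f (map \<beta> xs))"
      by (simp add: Hom0_D(3)[OF \<phi> bs] comp_def)
    finally show ?thesis
      using \<phi>c[OF B.kop_closed[OF bs]] \<phi>c[OF T_closed[OF qs]]
      by (simp add: \<psi>_oper[OF xs] Hom0_D(4)[OF \<phi> B.kop_closed[OF bs] T_closed[OF qs]] a_minus_def E.M.r_neg1)
  qed
  then have "pull (push \<phi>) = E.cobdry A ?h"
    unfolding pull_def push_def E.cobdry_def
    by (intro ext restrict_ext) (simp add: map_\<pi>_tuple)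
  moreover have "?h \<in> carrier A \<rightarrow> carrier E" using \<phi>c \<beta>_closed by auto
  ultimately have "pull (push \<phi>) \<in> coboundaries ar A E" by (auto simp: E.coboundaries_eq)
  then show "C \<in> kernel H2Q H2A (infl_H2 ar Eqs A \<pi> E)"
    using pZ by (simp add: kernel_def C infl_H2_class_eq_one_iff E.H2_carrier)
next
  fix C assume "C \<in> kernel H2Q H2A (infl_H2 ar Eqs A \<pi> E)"
  then obtain S where S: "S \<in> carrier ZQ" and C: "C = classQ S" and "pull S \<in> coboundaries ar A E"
    by (auto simp: kernel_def infl_H2_class_eq_one_iff E.H2_carrier)
  then obtain h where h: "h \<in> carrier A \<rightarrow> carrier E" and pS: "pull S = E.cobdry A h"
    by (auto simp: E.coboundaries_eq)
  have S': "S \<in> cocycles ar Q E" "is_compatible ar Eqs Q E S" using S by (auto simp: E.Z2_group_simps)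
  note Sm = E.compatible_m_zero[OF Q_variety S']
  have hS: "S f (map \<pi> xs) = kop E f (map h xs) \<ominus>\<^bsub>E\<^esub> h (oper A f xs)"
    if xs: "xs \<in> tuples (ar f) (carrier A)" for f xs
    using fun_cong[OF fun_cong[OF pS, of f], of xs] xs by (simp add: pull_def E.cobdry_def)
  note rh = restr_cobounding[OF E.cocycles_closed[OF S'(1)] Sm h hS]
  let ?k = "\<lambda>q. h (pt \<zero>\<^bsub>B\<^esub> q)"
  have "S \<otimes>\<^bsub>ZQ\<^esub> push (r h) = E.cobdry Q ?k"
    unfolding E.Z2_group_simps push_def
    using cobounding_transgr[OF E.cocycles_closed[OF S'(1)] Sm h hS]
    by (intro ext) (auto simp: E.cobdry_def restrict_def)
  moreover have "?k \<in> carrier Q \<rightarrow> carrier E" using h pt by auto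
  ultimately have SrT: "S \<otimes>\<^bsub>ZQ\<^esub> push (r h) \<in> coboundaries ar Q E" by (auto simp: E.coboundaries_eq)
  interpret HB: comm_group HB by (rule comm_group_HB)
  interpret H2Q: comm_group H2Q by (rule comm_group_H2Q)
  interpret ZQ: comm_group ZQ by (rule E.comm_group_Z2[OF Q_variety])
  interpret \<delta>: group_hom HB H2Q "transgr ar Eqs Q E T"
    by unfold_locales (rule transgr_hom)
  have pZ: "push (r h) \<in> carrier ZQ" by (rule hom_in_carrier[OF push_hom rh])
  have cS: "classQ S \<in> carrier H2Q" using S by (simp add: E.H2_carrier)
  have "classQ S \<otimes>\<^bsub>H2Q\<^esub> transgr ar Eqs Q E T (r h) = classQ (S \<otimes>\<^bsub>ZQ\<^esub> push (r h))"
    using hom_mult[OF E.H2_class_hom[OF Q_variety] S pZ] by (simp add: transgr_eq)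
  also have "\<dots> = \<one>\<^bsub>H2Q\<^esub>"
    using SrT by (simp add: E.H2_class_eq_one_iff[OF Q_variety ZQ.m_closed[OF S pZ]])
  finally have "C = inv\<^bsub>H2Q\<^esub> (transgr ar Eqs Q E T (r h))"
    using cS \<delta>.hom_closed[OF rh] C by (simp add: H2Q.inv_equality)
  \<comment> \<open>The homomorphism property of transgression absorbs the inverse, so the preimage
    of \<open>C\<close> is the negative of \<open>r h\<close>.\<close>
  also have "\<dots> = transgr ar Eqs Q E T (inv\<^bsub>HB\<^esub> r h)" using rh by simp
  finally show "C \<in> transgr ar Eqs Q E T ` carrier HB"
    using HB.inv_closed[OF rh] by (rule image_eqI)
qed

end

theorem theorem4p4:
  fixes ar :: "'f \<Rightarrow> nat"
    and Eqs :: "(('f, nat) trm \<times> ('f, nat) trm) set"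
    and m :: 'f
    and A :: "('f, 'a) ualg" and Q :: "('f, 'q) ualg" and \<pi> :: "'a \<Rightarrow> 'q"
    and R :: "'r ring" and B :: "('r, 'b, 'f) kernel_alg"
    and S :: "'s ring" and E :: "('s, 'e, 'f) kernel_alg"
    and T :: "'f \<Rightarrow> 'q list \<Rightarrow> 'b" and \<psi> :: "'a \<Rightarrow> 'b \<times> 'q"
  assumes "is_identity_set ar Eqs"
    and "difference_term ar Eqs m"
    and "in_variety ar Eqs A"
    and "central_datum ar Eqs m Q R B"
    and "central_extension ar A Q \<pi>"
    and "realizes_via ar Eqs A Q \<pi> B T \<psi>"
    and "is_kernel_alg ar m S E"
    and "in_variety ar Eqs (alg E)"
  shows
    "let HQ = Hom_group ar Q E; HA = Hom_group ar A E; HB = Hom0_group ar B E;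
         H2Q = H2_group ar Eqs Q E; H2A = H2_group ar Eqs A E;
         \<sigma> = infl_Hom A \<pi>; r = restr A Q \<psi> B E; \<delta> = transgr ar Eqs Q E T;
         \<sigma>2 = infl_H2 ar Eqs A \<pi> E
     in
       comm_group HQ \<and> comm_group HA \<and> comm_group HB \<and> comm_group H2Q \<and> comm_group H2A \<and>
       \<sigma> \<in> hom HQ HA \<and> r \<in> hom HA HB \<and> \<delta> \<in> hom HB H2Q \<and> \<sigma>2 \<in> hom H2Q H2A \<and>
       \<sigma> ` carrier HQ \<subseteq> kernel HA HB r \<and>
       r ` carrier HA \<subseteq> kernel HB H2Q \<delta> \<and>
       \<delta> ` carrier HB \<subseteq> kernel H2Q H2A \<sigma>2 \<and>
       kernel HQ HA \<sigma> = {\<one>\<^bsub>HQ\<^esub>} \<and>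
       \<sigma> ` carrier HQ = kernel HA HB r \<and>
       r ` carrier HA = kernel HB H2Q \<delta> \<and>
       ((\<exists>(X :: 'x set) \<theta>. free_presentation ar Eqs X \<theta> Q \<and>
            (\<exists>u. is_idempotent ar
                  (quot_alg (free_alg ar Eqs X)
                    (commutator ar (free_alg ar Eqs X) \<theta> (one_cong (free_alg ar Eqs X)))) u))
          \<longrightarrow> \<delta> ` carrier HB = kernel H2Q H2A \<sigma>2)"
proof -
  interpret realized_extension ar m R B S E Eqs A Q \<pi> T \<psi>
    using assms by unfold_locales (auto simp: central_datum_def)
  show ?thesis
    unfolding Let_def
    using comm_group_HQ comm_group_HA comm_group_HB comm_group_H2Q comm_group_H2A
      infl_Hom_hom restr_hom transgr_hom infl_H2_hom infl_Hom_kernel exact_at_HA exact_at_HB exact_at_H2Q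
    \<comment> \<open>\<open>equalityD1\<close> extracts the three inclusions that make the sequence
      a complex from the corresponding equalities of image and kernel.\<close>
    by (intro conjI impI) (assumption | rule equalityD1)+
qed

end
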